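(* Assume that for all $i\in\mathcal I$, $H(i,\cdot)$ is (strictly) increasing with respect to each coordinate. Let $\hat v_i(t)=U_i(t)-\gamma t$ for $(i,t)\in\mathcal I\times[0,+\infty)$, let $q(t)=\sup_{i\in\mathcal I}(\hat v_i(t)-\xi_i)$ for $t\in\mathbb R_+$, and let $q_\infty=\lim_{t\to+\infty}q(t)$ (which exists in $\mathbb R$). Then $$\forall i\in\mathcal I,\qquad\lim_{t\to+\infty}\hat v_i(t)=\xi_i+q_\infty.$$
   Context: $\mathcal I=\{1,\dots,N\}$ is the set of nodes of a finite strongly connected directed graph $\mathcal G$ (for any two nodes $i,j$ there is a directed path from $i$ to $j$). For $i\in\mathcal I$, $\mathcal V(i)\subset\mathcal I\setminus\{i\}$ is the set of nodes $j$ for which there is a directed edge from $i$ to $j$. $\mathbb R_+=[0,\infty)$, $\mathbb R_+^*=(0,\infty)$. For each $i\in\mathcal I$ a cost function $L(i,\cdot):\mathbb R_+^{|\mathcal V(i)|}\to\mathbb R\cup\{+\infty\}$ is given, with: (A1) for every $i$ there is a tuple $(\lambda_{ij})_{j\in\mathcal V(i)}$ with all entries in $\mathbb R_+^*$ such that $L(i,(\lambda_{ij})_j)<+\infty$; (A2) each $L(i,\cdot)$ is lower semi-continuous; (A3) there is $\underline C\in\mathbb R$ with $L(i,\lambda)\ge\underline C$ for all $i$ and all $\lambda\in\mathbb R_+^{|\mathcal V(i)|}$; (A4) for every $i$, $L(i,\lambda)/\|\lambda\|_\infty\to+\infty$ as $\|\lambda\|_\infty\to+\infty$. The Hamiltonian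 functions are $H(i,p)=\sup_{\lambda\in\mathbb R_+^{|\mathcal V(i)|}}\big(\sum_{j\in\mathcal V(i)}\lambda_{j}p_j-L(i,\lambda)\big)$ for $p\in\mathbb R^{|\mathcal V(i)|}$; they are real-valued. A terminal payoff $g:\mathcal I\to\mathbb R$ is fixed. All processes are defined on a filtered probability space satisfying the usual conditions and are adapted. For $0\le t\le T$, $\mathcal A^T_t$ is the set of families $(\lambda_s(i,j))_{s\in[t,T],i\in\mathcal I,j\in\mathcal V(i)}$ of non-negative deterministic functions with $s\mapsto\lambda_s(i,j)\in L^1(t,T)$ for all $i,j$. For $\lambda\in\mathcal A^T_t$, $(X^{t,i,\lambda}_s)_{s\in[t,T]}$ is the continuous-time Markov chain on $\mathcal I$ starting from node $i$ at time $t$ whose instantaneous transition rate at time $s$ from $k$ to $j\in\mathcal V(k)$ is $\lambda_s(k,j)$. For $r\ge0$, $$u^{T,r}_i(t)=\sup_{\lambda\in\mathcal A^T_t}\mathbb E\left[-\int_t^Te^{-r(s-t)}L\Big(X^{t,i,\lambda}_s,\big(\lambda_s(X^{t,i,\lambda}_s,j)\big)_{j\in\mathcal V(X^{t,i,\lambda}_s)}\Big)ds+e^{-r(T-t)}g\big(X^{t,i,\lambda}_T\big)\right].$$ For $r>0$ and $i\in\mathcal I$, $u^r_i=\lim_{T\to+\infty}u^{T,r}_i(t)\in\mathbb R$; this limit exists and does not depend on $t\in\mathbb R_+$. The limit $\gamma=\lim_{r\to0}ru^r_i$ exists in $\mathbb R$ and does not depend on $i$. A sequence $r_n>0$, $r_n\to0$,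 is fixed such that $\xi_i=\lim_{n\to\infty}(u^{r_n}_i-u^{r_n}_1)$ exists for all $i\in\mathcal I$ (such a sequence exists); then $-\gamma+H(i,(\xi_j-\xi_i)_{j\in\mathcal V(i)})=0$ for all $i\in\mathcal I$. $(U_i)_{i\in\mathcal I}$ denotes the unique continuously differentiable solution on $[0,+\infty)$ of $-\frac{d}{dt}U_i(t)+H(i,(U_j(t)-U_i(t))_{j\in\mathcal V(i)})=0$ with $U_i(0)=g(i)$, $i\in\mathcal I$; equivalently $U_i(t)=u^{T,0}_i(T-t)$ for $0\le t\le T$. *)

theory Defs
  imports "HOL-Probability.Probability"
begin

text \<open>
  The nodes are the elements of a finite type, and \<^term>\<open>V i\<close> is the set of out-neighbours
  of \<^term>\<open>i\<close>. A vector indexed by \<^term>\<open>V i\<close> is an extensional function on \<^term>\<open>V i\<close>, so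
  \<^term>\<open>V i \<rightarrow>\<^sub>E {0..}\<close> with the subspace topology of the product topology is the nonnegative orthant.
\<close>

definition strongly_connected_graph :: "('i \<Rightarrow> 'i set) \<Rightarrow> bool" where
  "strongly_connected_graph V \<longleftrightarrow>
     (\<forall>i. i \<notin> V i) \<and> (\<forall>i j. (i, j) \<in> {(k, l). l \<in> V k}\<^sup>*)"

text \<open>The inserted \<open>0\<close> only matters for empty \<open>A\<close> (a graph with a single node).\<close>

definition norm_infty :: "'i set \<Rightarrow> ('i \<Rightarrow> real) \<Rightarrow> real" where
  "norm_infty A x = Max (insert 0 ((\<lambda>j. \<bar>x j\<bar>) ` A))"

definition lower_semicontinuous_on :: "'a::topological_space set \<Rightarrow> ('a \<Rightarrow> ereal) \<Rightarrow> bool" where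
  "lower_semicontinuous_on S f \<longleftrightarrow> (\<forall>x\<in>S. f x \<le> Liminf (at x within S) f)"

definition superlinear_on :: "'i set \<Rightarrow> (('i \<Rightarrow> real) \<Rightarrow> ereal) \<Rightarrow> bool" where
  "superlinear_on A f \<longleftrightarrow>
     ((\<lambda>x. f x / ereal (norm_infty A x)) \<longlongrightarrow> \<infinity>)
       (inf (filtercomap (norm_infty A) at_top) (principal (A \<rightarrow>\<^sub>E {0..})))"

definition cost_functions ::
  "('i::finite \<Rightarrow> 'i set) \<Rightarrow> ('i \<Rightarrow> ('i \<Rightarrow> real) \<Rightarrow> ereal) \<Rightarrow> bool" where
  "cost_functions V L \<longleftrightarrow>
     (\<forall>i. \<exists>x \<in> V i \<rightarrow>\<^sub>E {0<..}. L i x < \<infinity>) \<and>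
     (\<forall>i. lower_semicontinuous_on (V i \<rightarrow>\<^sub>E {0..}) (L i)) \<and>
     (\<exists>C::real. \<forall>i. \<forall>x \<in> V i \<rightarrow>\<^sub>E {0..}. ereal C \<le> L i x) \<and>
     (\<forall>i. superlinear_on (V i) (L i))"

text \<open>
  The supremum is finite under \<^const>\<open>cost_functions\<close>, so \<^const>\<open>real_of_ereal\<close> is harmless there.
  Only the coordinates of \<open>p\<close> in \<^term>\<open>V i\<close> are used.
\<close>

definition hamiltonian ::
  "('i \<Rightarrow> 'i set) \<Rightarrow> ('i \<Rightarrow> ('i \<Rightarrow> real) \<Rightarrow> ereal) \<Rightarrow> 'i \<Rightarrow> ('i \<Rightarrow> real) \<Rightarrow> real" where
  "hamiltonian V L i p =
     real_of_ereal (SUP x \<in> V i \<rightarrow>\<^sub>E {0..}. ereal (\<Sum>j\<in>V i. x j * p j) - L i x)"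

definition C1_solution ::
  "('i \<Rightarrow> 'i set) \<Rightarrow> ('i \<Rightarrow> ('i \<Rightarrow> real) \<Rightarrow> ereal) \<Rightarrow> ('i \<Rightarrow> real) \<Rightarrow> ('i \<Rightarrow> real \<Rightarrow> real) \<Rightarrow> bool" where
  "C1_solution V L g U \<longleftrightarrow>
     (\<exists>U'. \<forall>i. continuous_on {0..} (U' i) \<and>
        (\<forall>t\<ge>0. (U i has_real_derivative U' i t) (at t within {0..}) \<and>
                - U' i t + hamiltonian V L i (\<lambda>j. U j t - U i t) = 0)) \<and>
     (\<forall>i. U i 0 = g i)"

text \<open>
  Integral of an extended real function as the difference of the integrals of its positive and
  negative parts (\<^const>\<open>e2ennreal\<close> sends negative values to \<open>0\<close>). It is used only for functions for
  which at least one of the two parts has a finite integral.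
\<close>

definition ereal_integral :: "'a measure \<Rightarrow> ('a \<Rightarrow> ereal) \<Rightarrow> ereal" where
  "ereal_integral M f =
     enn2ereal (\<integral>\<^sup>+x. e2ennreal (f x) \<partial>M) - enn2ereal (\<integral>\<^sup>+x. e2ennreal (- f x) \<partial>M)"

text \<open>Only times in \<open>[0, \<infinity>)\<close> are relevant.\<close>

definition usual_filtration :: "'w measure \<Rightarrow> (real \<Rightarrow> 'w measure) \<Rightarrow> bool" where
  "usual_filtration M F \<longleftrightarrow>
     (\<forall>s\<ge>0. subalgebra M (F s)) \<and>
     (\<forall>s s'. 0 \<le> s \<longrightarrow> s \<le> s' \<longrightarrow> sets (F s) \<subseteq> sets (F s')) \<and>
     complete_measure M \<and> null_sets M \<subseteq> sets (F 0) \<and>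
     (\<forall>s\<ge>0. sets (F s) = (\<Inter>s'\<in>{s<..}. sets (F s')))"

text \<open>\<^term>\<open>a s k j\<close> is the transition rate at time \<open>s\<close> from \<open>k\<close> to \<^term>\<open>j \<in> V k\<close>.\<close>

type_synonym 'i rates = "real \<Rightarrow> 'i \<Rightarrow> 'i \<Rightarrow> real"

definition admissible :: "('i \<Rightarrow> 'i set) \<Rightarrow> real \<Rightarrow> real \<Rightarrow> 'i rates set" where
  "admissible V t T =
     {a. \<forall>i. \<forall>j\<in>V i. (\<forall>s\<in>{t..T}. 0 \<le> a s i j) \<and> (\<lambda>s. a s i j) absolutely_integrable_on {t..T}}"

definition generator :: "('i::finite \<Rightarrow> 'i set) \<Rightarrow> ('i \<Rightarrow> 'i \<Rightarrow> real) \<Rightarrow> 'i \<Rightarrow> 'i \<Rightarrow> real" where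
  "generator V b k j =
     (if j = k then - (\<Sum>l\<in>V k. b k l) else if j \<in> V k then b k j else 0)"

text \<open>
  Transition probabilities with rates \<open>a\<close>. As the rates are merely integrable in time, Kolmogorov's
  forward equation is stated in integrated form.
\<close>

definition transition_function ::
  "('i::finite \<Rightarrow> 'i set) \<Rightarrow> real \<Rightarrow> real \<Rightarrow> 'i rates \<Rightarrow> (real \<Rightarrow> real \<Rightarrow> 'i \<Rightarrow> 'i \<Rightarrow> real) \<Rightarrow> bool" where
  "transition_function V t T a P \<longleftrightarrow>
     (\<forall>s s' k. t \<le> s \<longrightarrow> s \<le> s' \<longrightarrow> s' \<le> T \<longrightarrow>
        (\<forall>j. 0 \<le> P s s' k j) \<and> (\<Sum>j\<in>UNIV. P s s' k j) = 1 \<and>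
        (\<forall>j. ((\<lambda>u. \<Sum>l\<in>UNIV. P s u k l * generator V (a u) l j)
               has_integral (P s s' k j - (if j = k then 1 else 0))) {s..s'}))"

definition markov_chain_with_rates ::
  "'w measure \<Rightarrow> (real \<Rightarrow> 'w measure) \<Rightarrow> ('i::finite \<Rightarrow> 'i set) \<Rightarrow> real \<Rightarrow> real \<Rightarrow> 'i \<Rightarrow> 'i rates \<Rightarrow>
    (real \<Rightarrow> 'w \<Rightarrow> 'i) \<Rightarrow> bool" where
  "markov_chain_with_rates M F V t T i a X \<longleftrightarrow>
     (\<forall>s\<in>{t..T}. X s \<in> F s \<rightarrow>\<^sub>M count_space UNIV) \<and>
     (\<forall>\<omega>\<in>space M. (\<forall>s\<in>{t..<T}. \<forall>\<^sub>F u in at_right s. X u \<omega> = X s \<omega>) \<and>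
                    (\<forall>s\<in>{t<..T}. \<exists>k. \<forall>\<^sub>F u in at_left s. X u \<omega> = k)) \<and>
     (AE \<omega> in M. X t \<omega> = i) \<and>
     (\<exists>P. transition_function V t T a P \<and>
        (\<forall>s s' j. t \<le> s \<longrightarrow> s \<le> s' \<longrightarrow> s' \<le> T \<longrightarrow>
           (AE \<omega> in M. real_cond_exp M (F s) (indicator {\<omega>\<in>space M. X s' \<omega> = j}) \<omega>
                         = P s s' (X s \<omega>) j)))"

definition expected_payoff ::
  "'w measure \<Rightarrow> ('i \<Rightarrow> 'i set) \<Rightarrow> ('i \<Rightarrow> ('i \<Rightarrow> real) \<Rightarrow> ereal) \<Rightarrow> ('i \<Rightarrow> real) \<Rightarrow>
    real \<Rightarrow> real \<Rightarrow> real \<Rightarrow> 'i rates \<Rightarrow> (real \<Rightarrow> 'w \<Rightarrow> 'i) \<Rightarrow> ereal" where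
  "expected_payoff M V L g T r t a X =
     ereal_integral M (\<lambda>\<omega>.
       - ereal_integral (lebesgue_on {t..T})
           (\<lambda>s. ereal (exp (- r * (s - t))) * L (X s \<omega>) (restrict (a s (X s \<omega>)) (V (X s \<omega>))))
       + ereal (exp (- r * (T - t)) * g (X T \<omega>)))"

text \<open>Here \<^term>\<open>X t T i a\<close> is the chain on \<open>[t, T]\<close> started from \<open>i\<close> at time \<open>t\<close> with rates \<open>a\<close>.\<close>

definition value_function ::
  "'w measure \<Rightarrow> ('i \<Rightarrow> 'i set) \<Rightarrow> ('i \<Rightarrow> ('i \<Rightarrow> real) \<Rightarrow> ereal) \<Rightarrow> ('i \<Rightarrow> real) \<Rightarrow>
    (real \<Rightarrow> real \<Rightarrow> 'i \<Rightarrow> 'i rates \<Rightarrow> real \<Rightarrow> 'w \<Rightarrow> 'i) \<Rightarrow> real \<Rightarrow> real \<Rightarrow> 'i \<Rightarrow> real \<Rightarrow> ereal" where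
  "value_function M V L g X T r i t =
     (SUP a \<in> admissible V t T. expected_payoff M V L g T r t a (X t T i a))"

end

theory Submission
  imports Defs
begin

text \<open>
  A stationary solution \<open>w\<close> of \<open>r w\<^sub>i = H(i, (w\<^sub>j - w\<^sub>i)\<^sub>j)\<close> exists by Perron's method. By the forward
  equation of the controlled chain, the payoff of every control is at most
  \<open>w\<^sub>i + e\<^bsup>-rT\<^esup> max \<bar>g - w\<bar>\<close>, and nearly optimal constant rates almost reach \<open>w\<^sub>i\<close>. Hence the
  discounted value is \<open>w\<close>, and letting \<open>r\<close> tend to \<open>0\<close> along the given sequence yields
  \<open>\<gamma> = H(i, (\<xi>\<^sub>j - \<xi>\<^sub>i)\<^sub>j)\<close>.

  Thus \<open>z\<^sub>i = v\<^sub>i - \<xi>\<^sub>i\<close> solves an autonomous cooperative system having the constant vectors as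
  equilibria. Its maximal coordinate decreases and its minimal coordinate increases. At a limit
  point some coordinate equals the limit of the maximum and has zero velocity, so strict
  monotonicity forces its neighbours to be maximal as well, and strong connectivity does the rest.
\<close>

section \<open>The Hamiltonian and the stationary equation\<close>

text \<open>The equation for \<open>\<gamma>\<close> and \<open>\<xi>\<close> has to be extracted
  from payoffs of genuine controlled chains. The running cost along a path may be infinite, so
  Fubini and Kolmogorov's equation are applied not to it but to a finite cost \<open>l\<close>: the
  generator applied to a fixed vector \<open>w\<close>, minus \<open>r * w\<close>. The payoff with
  cost \<open>l\<close> has an exact formula, and the duality between \<open>L\<close> and the
  Hamiltonian becomes a comparison of payoffs through monotonicity of the integral. This
  verification argument replaces dynamic programming: the discounted equation is solved
  independently of the chains, and its solution is then recognised as the value.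

  For the flow, the usual limit set argument would follow new solutions started at limit points.
  Here only the given orbit is used: its speed is bounded, so near a limit point a nonzero velocity
  persists over a time window of fixed length.\<close>

lemma cost_functionsD:
  assumes "cost_functions V L"
  shows "\<exists>x \<in> V i \<rightarrow>\<^sub>E {0<..}. L i x < \<infinity>"
    and "\<exists>C::real. \<forall>i. \<forall>x \<in> V i \<rightarrow>\<^sub>E {0..}. ereal C \<le> L i x"
    and "superlinear_on (V i) (L i)"
  using assms unfolding cost_functions_def by blast+

text \<open>A point of finite cost bounds the supremum from below. From above, the pairing with
  \<open>p\<close> is at most \<open>norm_infty\<close> times the sum \<open>R\<close> of the
  \<open>\<bar>p j\<bar>\<close>: superlinear growth beats this far out, and the uniform lower bound
  \<open>C\<close> handles the rest. Finiteness makes \<open>real_of_ereal\<close> transparent in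
  all that follows.\<close>

lemma hamiltonian_ereal:
  assumes cost: "cost_functions V L"
  shows "ereal (hamiltonian V L i p) =
    (SUP x \<in> V i \<rightarrow>\<^sub>E {0..}. ereal (\<Sum>j\<in>V i. x j * p j) - L i x)" (is "_ = ?S")
proof -
  obtain C :: real where C: "\<And>x. x \<in> V i \<rightarrow>\<^sub>E {0..} \<Longrightarrow> ereal C \<le> L i x"
    using cost_functionsD(2)[OF cost] by metis
  obtain x0 where x0: "x0 \<in> V i \<rightarrow>\<^sub>E {0<..}" "L i x0 < \<infinity>"
    using cost_functionsD(1)[OF cost] by metis
  have x0': "x0 \<in> V i \<rightarrow>\<^sub>E {0..}"
    using x0(1) by (auto simp: PiE_def Pi_def less_imp_le)
  have "-\<infinity> < ereal (\<Sum>j\<in>V i. x0 j * p j) - L i x0"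
    using x0(2) by (cases "L i x0") auto
  also have "\<dots> \<le> ?S"
    by (rule SUP_upper[OF x0'])
  finally have lower: "-\<infinity> < ?S" .
  define R where "R = (\<Sum>j\<in>V i. \<bar>p j\<bar>)"
  have R0: "0 \<le> R"
    unfolding R_def by (simp add: sum_nonneg)
  have "eventually (\<lambda>x. ereal R < L i x / ereal (norm_infty (V i) x))
      (inf (filtercomap (norm_infty (V i)) at_top) (principal (V i \<rightarrow>\<^sub>E {0..})))"
    using cost_functionsD(3)[OF cost, of i] unfolding superlinear_on_def tendsto_PInfty by simp
  then obtain B where B: "\<And>x. x \<in> V i \<rightarrow>\<^sub>E {0..} \<Longrightarrow> B \<le> norm_infty (V i) x \<Longrightarrow>
      ereal R < L i x / ereal (norm_infty (V i) x)"
    unfolding eventually_inf_principal eventually_filtercomap_at_top_linorder by blast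
  \<comment> \<open>At least 1, so that the norm is positive in the outer region and the quotient
    bound can be multiplied out.\<close>
  define B' where "B' = max B 1"
  have "ereal (\<Sum>j\<in>V i. x j * p j) - L i x \<le> ereal (max 0 (B' * R - C))"
    if x: "x \<in> V i \<rightarrow>\<^sub>E {0..}" for x
  proof -
    let ?n = "norm_infty (V i) x"
    have le: "\<bar>x j\<bar> \<le> ?n" if "j \<in> V i" for j
      unfolding norm_infty_def using that by (intro Max_ge) auto
    have "(\<Sum>j\<in>V i. x j * p j) \<le> (\<Sum>j\<in>V i. ?n * \<bar>p j\<bar>)"
    proof (rule sum_mono)
      fix j assume "j \<in> V i"
      have "x j * p j \<le> \<bar>x j\<bar> * \<bar>p j\<bar>"
        by (metis abs_ge_self abs_mult)
      also have "\<dots> \<le> ?n * \<bar>p j\<bar>"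
        using le[OF \<open>j \<in> V i\<close>] by (intro mult_right_mono) auto
      finally show "x j * p j \<le> ?n * \<bar>p j\<bar>" .
    qed
    then have s: "(\<Sum>j\<in>V i. x j * p j) \<le> ?n * R"
      by (simp add: R_def sum_distrib_left)
    show ?thesis
    proof (cases "B' \<le> ?n")
      case True
      then have n: "B \<le> ?n" "0 < ?n"
        by (auto simp: B'_def)
      have "ereal (?n * R) \<le> L i x"
        using B[OF x n(1)] n(2)
        by (cases "L i x") (auto simp: field_simps)
      with s have "ereal (\<Sum>j\<in>V i. x j * p j) - L i x \<le> ereal 0"
        by (cases "L i x") auto
      then show ?thesis
        by (rule order_trans) simp
    next
      case False
      then have "?n * R \<le> B' * R"
        using R0 by (intro mult_right_mono) auto
      with s C[OF x] have "ereal (\<Sum>j\<in>V i. x j * p j) - L i x \<le> ereal (B' * R - C)"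
        by (cases "L i x") auto
      then show ?thesis
        by (rule order_trans) simp
    qed
  qed
  then have "?S \<le> ereal (max 0 (B' * R - C))"
    by (rule SUP_least)
  also have "\<dots> < \<infinity>"
    by (simp only: less_ereal.simps)
  finally have "\<bar>?S\<bar> \<noteq> \<infinity>"
    using lower by auto
  then show ?thesis
    unfolding hamiltonian_def by (rule ereal_real')
qed

lemma cost_ge_hamiltonian:
  assumes cost: "cost_functions V L" and x: "x \<in> V i \<rightarrow>\<^sub>E {0..}"
  shows "ereal ((\<Sum>j\<in>V i. x j * p j) - hamiltonian V L i p) \<le> L i x"
proof -
  have "ereal (\<Sum>j\<in>V i. x j * p j) - L i x \<le> ereal (hamiltonian V L i p)"
    unfolding hamiltonian_ereal[OF cost] by (rule SUP_upper[OF x])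
  then show ?thesis
    by (cases "L i x") auto
qed

text \<open>Legendre duality: upper bounds of the Hamiltonian correspond to affine minorants of
  \<open>L\<close> with slope \<open>p\<close>. Near optimality, monotonicity and convexity are read
  off from this form, in which the possibly infinite cost stands alone on one side.\<close>

lemma hamiltonian_le_iff:
  assumes cost: "cost_functions V L"
  shows "hamiltonian V L i p \<le> c \<longleftrightarrow>
    (\<forall>x \<in> V i \<rightarrow>\<^sub>E {0..}. ereal ((\<Sum>j\<in>V i. x j * p j) - c) \<le> L i x)"
proof -
  have "hamiltonian V L i p \<le> c \<longleftrightarrow> ereal (hamiltonian V L i p) \<le> ereal c"
    by simp
  also have "\<dots> \<longleftrightarrow> (\<forall>x \<in> V i \<rightarrow>\<^sub>E {0..}. ereal (\<Sum>j\<in>V i. x j * p j) - L i x \<le> ereal c)"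
    unfolding hamiltonian_ereal[OF cost] SUP_le_iff ..
  also have "\<dots> \<longleftrightarrow> (\<forall>x \<in> V i \<rightarrow>\<^sub>E {0..}. ereal ((\<Sum>j\<in>V i. x j * p j) - c) \<le> L i x)"
  proof (intro ball_cong refl)
    fix x
    show "ereal (\<Sum>j\<in>V i. x j * p j) - L i x \<le> ereal c \<longleftrightarrow>
        ereal ((\<Sum>j\<in>V i. x j * p j) - c) \<le> L i x"
      by (cases "L i x") auto
  qed
  finally show ?thesis .
qed

lemma cost_near_hamiltonian:
  assumes cost: "cost_functions V L" and "0 < e"
  shows "\<exists>x \<in> V i \<rightarrow>\<^sub>E {0..}.
    L i x \<le> ereal ((\<Sum>j\<in>V i. x j * p j) - hamiltonian V L i p + e)"
proof (rule ccontr)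
  assume "\<not> ?thesis"
  then have "\<forall>x \<in> V i \<rightarrow>\<^sub>E {0..}.
      ereal ((\<Sum>j\<in>V i. x j * p j) - (hamiltonian V L i p - e)) \<le> L i x"
    by (auto simp: not_le algebra_simps intro: less_imp_le)
  then have "hamiltonian V L i p \<le> hamiltonian V L i p - e"
    unfolding hamiltonian_le_iff[OF cost] .
  with \<open>0 < e\<close> show False
    by simp
qed

text \<open>Rates are nonnegative, so lowering the slopes keeps an affine minorant of
  \<open>L\<close> below \<open>L\<close>.\<close>

lemma hamiltonian_mono:
  fixes V :: "'i::finite \<Rightarrow> 'i set"
  assumes cost: "cost_functions V L" and le: "\<And>j. j \<in> V i \<Longrightarrow> p j \<le> p' j"
  shows "hamiltonian V L i p \<le> hamiltonian V L i p'"
  unfolding hamiltonian_le_iff[OF cost]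
proof
  fix x :: "'i \<Rightarrow> real" assume x: "x \<in> V i \<rightarrow>\<^sub>E {0..}"
  have "(\<Sum>j\<in>V i. x j * p j) \<le> (\<Sum>j\<in>V i. x j * p' j)"
    using x le by (intro sum_mono mult_left_mono) (auto simp: PiE_iff)
  then have "ereal ((\<Sum>j\<in>V i. x j * p j) - hamiltonian V L i p') \<le>
      ereal ((\<Sum>j\<in>V i. x j * p' j) - hamiltonian V L i p')"
    by simp
  also have "\<dots> \<le> L i x"
    by (rule cost_ge_hamiltonian[OF cost x])
  finally show "ereal ((\<Sum>j\<in>V i. x j * p j) - hamiltonian V L i p') \<le> L i x" .
qed

text \<open>The coordinates other than \<open>j\<close> are raised by weak monotonicity, then
  \<open>j\<close> alone by strictness. This gives the vector form needed to compare a node with all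
  its neighbours at once.\<close>

lemma hamiltonian_strict_mono:
  assumes cost: "cost_functions V L"
    and strict: "\<And>i j p x y. j \<in> V i \<Longrightarrow> x < y \<Longrightarrow>
                   hamiltonian V L i (p(j := x)) < hamiltonian V L i (p(j := y))"
    and le: "\<And>j. j \<in> V i \<Longrightarrow> p j \<le> p' j" and j: "j \<in> V i" "p j < p' j"
  shows "hamiltonian V L i p < hamiltonian V L i p'"
proof -
  have "hamiltonian V L i p \<le> hamiltonian V L i (p'(j := p j))"
    using le by (intro hamiltonian_mono[OF cost]) auto
  also have "\<dots> < hamiltonian V L i (p'(j := p' j))"
    by (rule strict[OF j])
  finally show ?thesis
    by simp
qed

text \<open>A supremum of affine functions is convex, and a finite convex function on a Euclidean
  space is continuous. The vectors live in \<open>real^'i\<close> for the sake of this theorem;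
  coordinates outside \<open>V i\<close> do not enter the value.\<close>

lemma continuous_on_hamiltonian:
  assumes cost: "cost_functions V L"
  shows "continuous_on UNIV (\<lambda>x::real^'i::finite. hamiltonian V L i (($) x))"
proof (rule convex_on_continuous[OF open_UNIV], rule convex_onI)
  fix t :: real and p p' :: "real^'i"
  let ?H = "\<lambda>x::real^'i. hamiltonian V L i (($) x)"
  assume t: "0 < t" "t < 1"
  show "?H ((1 - t) *\<^sub>R p + t *\<^sub>R p') \<le> (1 - t) * ?H p + t * ?H p'"
    unfolding hamiltonian_le_iff[OF cost]
  proof
    fix x :: "'i \<Rightarrow> real" assume x: "x \<in> V i \<rightarrow>\<^sub>E {0..}"
    have eq: "(\<Sum>j\<in>V i. x j * ((1 - t) *\<^sub>R p + t *\<^sub>R p') $ j) =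
        (1 - t) * (\<Sum>j\<in>V i. x j * p $ j) + t * (\<Sum>j\<in>V i. x j * p' $ j)"
      by (simp add: sum_distrib_left sum.distrib algebra_simps sum_subtractf)
    have 1: "ereal ((\<Sum>j\<in>V i. x j * p $ j) - ?H p) \<le> L i x"
      and 2: "ereal ((\<Sum>j\<in>V i. x j * p' $ j) - ?H p') \<le> L i x"
      by (rule cost_ge_hamiltonian[OF cost x])+
    show "ereal ((\<Sum>j\<in>V i. x j * ((1 - t) *\<^sub>R p + t *\<^sub>R p') $ j) - ((1 - t) * ?H p + t * ?H p'))
        \<le> L i x"
    proof (cases "L i x")
      case (real l)
      have "(1 - t) * ((\<Sum>j\<in>V i. x j * p $ j) - ?H p) + t * ((\<Sum>j\<in>V i. x j * p' $ j) - ?H p')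
          \<le> (1 - t) * l + t * l"
        using 1 2 real t by (intro add_mono mult_left_mono) auto
      then show ?thesis
        unfolding eq real by (simp add: algebra_simps)
    qed (use 1 in auto)
  qed
qed auto

lemma tendsto_hamiltonian:
  fixes V :: "'i::finite \<Rightarrow> 'i set"
  assumes cost: "cost_functions V L" and lim: "\<And>j. ((\<lambda>x. p x j) \<longlongrightarrow> p' j) G"
  shows "((\<lambda>x. hamiltonian V L i (p x)) \<longlongrightarrow> hamiltonian V L i p') G"
proof -
  have v: "((\<lambda>x. \<chi> j. p x j) \<longlongrightarrow> (\<chi> j. p' j)) G"
    by (rule vec_tendstoI) (simp add: lim)
  have "isCont (\<lambda>x::real^'i. hamiltonian V L i (($) x)) (\<chi> j. p' j)"
    using continuous_on_hamiltonian[OF cost] by (simp add: continuous_on_eq_continuous_at)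
  from isCont_tendsto_compose[OF this v] show ?thesis
    by (simp add: vec_lambda_inverse)
qed

text \<open>Perron's method: the solution is the supremum of the subsolutions.\<close>

lemma stationary_solution_exists:
  fixes V :: "'i::finite \<Rightarrow> 'i set"
  assumes cost: "cost_functions V L" and r: "0 < r"
  shows "\<exists>w. \<forall>i. r * w i = hamiltonian V L i (\<lambda>j. w j - w i)"
proof -
  let ?H = "\<lambda>i w. hamiltonian V L i (\<lambda>j. w j - w i)"
  define S where "S = {w::'i \<Rightarrow> real. \<forall>i. r * w i \<le> ?H i w}"
  \<comment> \<open>Barriers from constant vectors, whose differences vanish: looking at a maximal
    node, every subsolution is at most \<open>c / r\<close>, and the constant \<open>d / r\<close>
    is itself a subsolution.\<close>
  define c where "c = Max (range (\<lambda>i. hamiltonian V L i (\<lambda>_. 0)))"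
  define d where "d = Min (range (\<lambda>i. hamiltonian V L i (\<lambda>_. 0)))"
  have bound: "w i \<le> c / r" if w: "w \<in> S" for w i
  proof -
    have "Max (range w) \<in> range w"
      by (rule Max_in) auto
    then obtain k where k: "w k = Max (range w)"
      by (metis imageE)
    then have le: "w j \<le> w k" for j
      by simp
    have "r * w k \<le> ?H k w"
      using w by (auto simp: S_def)
    also have "\<dots> \<le> hamiltonian V L k (\<lambda>_. 0)"
      using le by (intro hamiltonian_mono[OF cost]) simp
    also have "\<dots> \<le> c"
      unfolding c_def by simp
    finally have "w k \<le> c / r"
      using r by (simp add: field_simps)
    with le[of i] show ?thesis
      by simp
  qed
  have "(\<lambda>_. d / r) \<in> S"
    using r by (auto simp: S_def d_def)
  then have ne: "S \<noteq> {}"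
    by blast
  have bdd: "bdd_above ((\<lambda>w. w i) ` S)" for i
    using bound by (auto intro!: bdd_aboveI)
  define W where "W i = (SUP w\<in>S. w i)" for i
  have le_W: "w i \<le> W i" if "w \<in> S" for w i
    unfolding W_def by (rule cSUP_upper[OF that bdd])
  \<comment> \<open>For \<open>x\<close> below \<open>W i\<close> some subsolution has
    \<open>w i\<close> above \<open>x\<close>. Its differences seen from \<open>i\<close> are at
    most \<open>W j - x\<close>, so the inequality holds with \<open>x\<close>, and continuity lets
    \<open>x\<close> tend to \<open>W i\<close>. The subsolution may vary with \<open>i\<close> and
    \<open>x\<close>.\<close>
  have sub: "r * W i \<le> ?H i W" for i
  proof (rule tendsto_le[where F = "at_left (W i)"])
    show "((\<lambda>x. r * x) \<longlongrightarrow> r * W i) (at_left (W i))"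
      by (intro tendsto_intros)
    show "((\<lambda>x. hamiltonian V L i (\<lambda>j. W j - x)) \<longlongrightarrow> ?H i W) (at_left (W i))"
      by (intro tendsto_hamiltonian[OF cost] tendsto_intros)
    have "r * x \<le> hamiltonian V L i (\<lambda>j. W j - x)" if x: "x < W i" for x
    proof -
      obtain w where w: "w \<in> S" "x < w i"
        using x less_cSUP_iff[OF ne bdd, of x i] by (auto simp: W_def)
      have "r * x \<le> r * w i"
        using w r by simp
      also have "\<dots> \<le> ?H i w"
        using w by (auto simp: S_def)
      also have "\<dots> \<le> hamiltonian V L i (\<lambda>j. W j - x)"
        using w le_W[OF w(1)] by (intro hamiltonian_mono[OF cost]) (smt (verit))
      finally show ?thesis .
    qed
    then show "\<forall>\<^sub>F x in at_left (W i). r * x \<le> hamiltonian V L i (\<lambda>j. W j - x)"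
      by (simp add: eventually_at_filter)
  qed simp
  \<comment> \<open>If the inequality were strict at \<open>i\<close>, raising coordinate
    \<open>i\<close> alone by a little would preserve it there by continuity, and at the other nodes
    by monotonicity. The result would be a subsolution exceeding the supremum
    \<open>W\<close>.\<close>
  have "r * W i = ?H i W" for i
  proof (rule ccontr)
    assume "r * W i \<noteq> ?H i W"
    with sub[of i] have less: "r * W i < ?H i W"
      by simp
    have "((\<lambda>x. ?H i (W(i := x))) \<longlongrightarrow> ?H i (W(i := W i))) (at_right (W i))"
    proof (rule tendsto_hamiltonian[OF cost])
      fix j
      show "((\<lambda>x. (W(i := x)) j - (W(i := x)) i) \<longlongrightarrow>
          (W(i := W i)) j - (W(i := W i)) i) (at_right (W i))"
        by (cases "j = i") (auto intro!: tendsto_intros)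
    qed
    then have "((\<lambda>x. ?H i (W(i := x)) - r * x) \<longlongrightarrow> ?H i W - r * W i) (at_right (W i))"
      by (intro tendsto_intros) simp
    then have "\<forall>\<^sub>F x in at_right (W i). 0 < ?H i (W(i := x)) - r * x"
      using less by (intro order_tendstoD) auto
    moreover have "\<forall>\<^sub>F x in at_right (W i). W i < x"
      by (simp add: eventually_at_right_less)
    ultimately have "\<forall>\<^sub>F x in at_right (W i). 0 < ?H i (W(i := x)) - r * x \<and> W i < x"
      by eventually_elim simp
    then obtain x where x: "0 < ?H i (W(i := x)) - r * x" "W i < x"
      using eventually_happens'[OF trivial_limit_at_right_real] by blast
    have "W(i := x) \<in> S"
      unfolding S_def
    proof (intro CollectI allI)
      fix k
      show "r * (W(i := x)) k \<le> ?H k (W(i := x))"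
      proof (cases "k = i")
        case False
        have "r * W k \<le> ?H k W"
          by (rule sub)
        also have "\<dots> \<le> ?H k (W(i := x))"
          using x False by (intro hamiltonian_mono[OF cost]) auto
        finally show ?thesis
          using False by simp
      qed (use x in simp)
    qed
    from le_W[OF this, of i] x show False
      by simp
  qed
  then show ?thesis
    by blast
qed

section \<open>Payoffs of controlled chains\<close>

text \<open>The nonnegative integral is a supremum over simple functions below the integrand, hence
  monotone for arbitrary functions. Running costs can therefore be compared pointwise, infinite
  values included.\<close>

lemma ereal_integral_mono:
  assumes "\<And>x. x \<in> space M \<Longrightarrow> f x \<le> h x"
  shows "ereal_integral M f \<le> ereal_integral M h"
  unfolding ereal_integral_def
  using assms
  by (intro ereal_minus_mono) (auto simp: less_eq_ennreal.rep_eq[symmetric] intro!: nn_integral_mono e2ennreal_mono)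

lemma ereal_integral_cong:
  assumes "\<And>x. x \<in> space M \<Longrightarrow> f x = h x"
  shows "ereal_integral M f = ereal_integral M h"
  using assms by (intro antisym ereal_integral_mono) auto

lemma ereal_integral_ereal:
  assumes "integrable M f"
  shows "ereal_integral M (\<lambda>x. ereal (f x)) = ereal (\<integral>x. f x \<partial>M)"
proof -
  have fin: "(\<integral>\<^sup>+x. ennreal (f x) \<partial>M) \<noteq> \<infinity>" "(\<integral>\<^sup>+x. ennreal (- f x) \<partial>M) \<noteq> \<infinity>"
    using integrableD(2,3)[OF assms] by auto
  have "enn2ereal y = ereal (enn2real y)" if "y \<noteq> \<infinity>" for y
    using that by (cases y) (auto simp: enn2ereal_ennreal)
  with fin show ?thesis
    unfolding ereal_integral_def real_lebesgue_integral_def[OF assms]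
    by (simp add: e2ennreal_ereal)
qed

text \<open>The path is approximated by its value at a grid time just after \<open>s\<close>. Only
  countably many grid times occur, so each approximation is jointly measurable. Paths are constant
  immediately to the right, so the approximations are eventually equal to the path, not merely
  close.\<close>

lemma right_continuous_jointly_measurable:
  fixes Y :: "real \<Rightarrow> 'w \<Rightarrow> 'i::finite"
  assumes meas: "\<And>s. s \<in> {0..T} \<Longrightarrow> Y s \<in> M \<rightarrow>\<^sub>M count_space UNIV"
    and rc: "\<And>\<omega> s. \<omega> \<in> space M \<Longrightarrow> s \<in> {0..<T} \<Longrightarrow> \<forall>\<^sub>F u in at_right s. Y u \<omega> = Y s \<omega>"
  shows "(\<lambda>x. Y (fst x) (snd x)) \<in> lebesgue_on {0..T} \<Otimes>\<^sub>M M \<rightarrow>\<^sub>M count_space UNIV"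
proof -
  let ?P = "lebesgue_on {0..T} \<Otimes>\<^sub>M M"
  \<comment> \<open>Upper grid points: right constancy says nothing about times before
    \<open>s\<close>, and the added 1 makes the point exceed \<open>s\<close> strictly. Clipping at
    \<open>T\<close> makes the value at \<open>s = T\<close> exact.\<close>
  define u where "u n m = max 0 (min T ((real_of_int m + 1) / real (Suc n)))" for n m
  define k where "k n s = \<lfloor>s * real (Suc n)\<rfloor>" for n s
  have fst_meas: "fst \<in> borel_measurable ?P"
    by (rule measurable_compose[OF measurable_fst]) (intro measurable_restrict_space1 measurable_completion, simp)
  have u_meas: "(\<lambda>x. Y (u n (k n (fst x))) (snd x)) \<in> ?P \<rightarrow>\<^sub>M count_space UNIV" for n
  proof (cases "T < 0")
    case True
    then have "space ?P = {}"
      by (simp add: space_pair_measure)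
    then show ?thesis
      by (auto simp: measurable_def)
  next
    case False
    show ?thesis
    proof (rule measurable_compose_countable[where f = "\<lambda>m x. Y (u n m) (snd x)" and g = "\<lambda>x. k n (fst x)"])
      fix m
      have "u n m \<in> {0..T}"
        using False by (auto simp: u_def)
      then show "(\<lambda>x. Y (u n m) (snd x)) \<in> ?P \<rightarrow>\<^sub>M count_space UNIV"
        by (intro measurable_compose[OF measurable_snd meas])
      show "(\<lambda>x. k n (fst x)) \<in> ?P \<rightarrow>\<^sub>M count_space UNIV"
        unfolding k_def using fst_meas by measurable
    qed
  qed
  have u_lim: "\<forall>\<^sub>F n in sequentially. Y (u n (k n s)) \<omega> = Y s \<omega>"
    if s: "s \<in> {0..T}" and \<omega>: "\<omega> \<in> space M" for s \<omega>
  proof (cases "s = T")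
    case True
    have "u n (k n s) = s" for n
    proof -
      have "s * real (Suc n) < real_of_int (k n s) + 1"
        unfolding k_def by linarith
      then have "s < (real_of_int (k n s) + 1) / real (Suc n)"
        by (simp add: field_simps)
      then show ?thesis
        using s True by (simp add: u_def)
    qed
    then show ?thesis
      by simp
  next
    case False
    with s have sT: "s \<in> {0..<T}"
      by auto
    have gt: "s < u n (k n s)" for n
    proof -
      have "s * real (Suc n) < real_of_int (k n s) + 1"
        unfolding k_def by linarith
      then have "s < (real_of_int (k n s) + 1) / real (Suc n)"
        by (simp add: field_simps)
      then show ?thesis
        using sT by (auto simp: u_def)
    qed
    have le: "u n (k n s) \<le> s + 1 / real (Suc n)" for n
    proof -
      have "real_of_int (k n s) + 1 \<le> s * real (Suc n) + 1"
        unfolding k_def by linarith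
      then have "(real_of_int (k n s) + 1) / real (Suc n) \<le> (s * real (Suc n) + 1) / real (Suc n)"
        by (intro divide_right_mono) auto
      also have "\<dots> = s + 1 / real (Suc n)"
        by (simp add: field_simps)
      finally show ?thesis
        using sT by (auto simp: u_def)
    qed
    have "(\<lambda>n. u n (k n s)) \<longlonglongrightarrow> s"
    proof (rule tendsto_sandwich[OF _ _ tendsto_const])
      show "(\<lambda>n. s + 1 / real (Suc n)) \<longlonglongrightarrow> s"
        using tendsto_add[OF tendsto_const LIMSEQ_inverse_real_of_nat, of s]
        by (simp add: inverse_eq_divide)
      show "\<forall>\<^sub>F n in sequentially. s \<le> u n (k n s)"
        using gt by (intro always_eventually) (auto intro: less_imp_le)
      show "\<forall>\<^sub>F n in sequentially. u n (k n s) \<le> s + 1 / real (Suc n)"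
        using le by (intro always_eventually) blast
    qed
    moreover have "u n (k n s) \<noteq> s" for n
      using gt[of n] by simp
    ultimately have "filterlim (\<lambda>n. u n (k n s)) (at_right s) sequentially"
      using gt by (auto simp: filterlim_at)
    then show ?thesis
      using rc[OF \<omega> sT] by (rule eventually_compose_filterlim[rotated])
  qed
  have "{x \<in> space ?P. Y (fst x) (snd x) = i} \<in> sets ?P" for i
  proof -
    have "(\<lambda>x. indicator {i} (Y (fst x) (snd x)) :: real) \<in> borel_measurable ?P"
    proof (rule borel_measurable_LIMSEQ_real)
      fix x assume "x \<in> space ?P"
      then have "fst x \<in> {0..T}" "snd x \<in> space M"
        by (auto simp: space_pair_measure)
      then have "\<forall>\<^sub>F n in sequentially. indicator {i} (Y (u n (k n (fst x))) (snd x)) =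
          (indicator {i} (Y (fst x) (snd x)) :: real)"
        by (rule eventually_mono[OF u_lim]) simp
      then show "(\<lambda>n. indicator {i} (Y (u n (k n (fst x))) (snd x)) :: real) \<longlonglongrightarrow>
          indicator {i} (Y (fst x) (snd x))"
        by (rule tendsto_eventually)
    next
      fix n
      show "(\<lambda>x. indicator {i} (Y (u n (k n (fst x))) (snd x)) :: real) \<in> borel_measurable ?P"
        by (rule measurable_compose[OF u_meas]) simp
    qed
    then have "(\<lambda>x. indicator {i} (Y (fst x) (snd x)) :: real) -` {1} \<inter> space ?P \<in> sets ?P"
      by (rule measurable_sets) simp
    also have "(\<lambda>x. indicator {i} (Y (fst x) (snd x)) :: real) -` {1} \<inter> space ?P =
        {x \<in> space ?P. Y (fst x) (snd x) = i}"
      by (auto simp: indicator_def split: if_splits)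
    finally show ?thesis .
  qed
  then show ?thesis
    unfolding measurable_count_space_eq2_countable
    by (auto simp: vimage_def Int_def conj_commute)
qed

section \<open>Expected time integrals and discounting\<close>

lemma finite_measure_lebesgue_on_interval: "finite_measure (lebesgue_on {a..b::real})"
  by (rule finite_measure_lebesgue_on) simp

lemma expectation_finite_range:
  fixes Y :: "'w \<Rightarrow> 'i::finite" and h :: "'i \<Rightarrow> real"
  assumes "prob_space M" and Y: "Y \<in> M \<rightarrow>\<^sub>M count_space UNIV"
  shows "integrable M (\<lambda>\<omega>. h (Y \<omega>))"
    and "(\<integral>\<omega>. h (Y \<omega>) \<partial>M) = (\<Sum>k\<in>UNIV. h k * measure M {\<omega> \<in> space M. Y \<omega> = k})"
proof -
  interpret prob_space M by fact
  have sets: "{\<omega> \<in> space M. Y \<omega> = k} \<in> sets M" for k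
    using Y by measurable
  have "h (Y \<omega>) = (\<Sum>k\<in>UNIV. h k * indicator {\<omega> \<in> space M. Y \<omega> = k} \<omega>)" if "\<omega> \<in> space M" for \<omega>
    using that by (simp add: indicator_def if_distrib[of "\<lambda>x. h _ * x"] sum.delta' cong: if_cong)
  note eq = this
  have int: "integrable M (\<lambda>\<omega>. h k * indicator {\<omega> \<in> space M. Y \<omega> = k} \<omega>)" for k
    using sets by (intro integrable_mult_right integrable_real_indicator) (auto simp: emeasure_eq_measure)
  have "integrable M (\<lambda>\<omega>. \<Sum>k\<in>UNIV. h k * indicator {\<omega> \<in> space M. Y \<omega> = k} \<omega>)"
    using int by (intro Bochner_Integration.integrable_sum)
  moreover have "integrable M (\<lambda>\<omega>. h (Y \<omega>)) \<longleftrightarrow>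
      integrable M (\<lambda>\<omega>. \<Sum>k\<in>UNIV. h k * indicator {\<omega> \<in> space M. Y \<omega> = k} \<omega>)"
    by (intro Bochner_Integration.integrable_cong refl eq)
  ultimately show "integrable M (\<lambda>\<omega>. h (Y \<omega>))"
    by simp
  have "(\<integral>\<omega>. h (Y \<omega>) \<partial>M) =
      (\<integral>\<omega>. (\<Sum>k\<in>UNIV. h k * indicator {\<omega> \<in> space M. Y \<omega> = k} \<omega>) \<partial>M)"
    by (intro Bochner_Integration.integral_cong refl eq)
  also have "\<dots> = (\<Sum>k\<in>UNIV. \<integral>\<omega>. h k * indicator {\<omega> \<in> space M. Y \<omega> = k} \<omega> \<partial>M)"
    using int by (intro Bochner_Integration.integral_sum)
  finally show "(\<integral>\<omega>. h (Y \<omega>) \<partial>M) = (\<Sum>k\<in>UNIV. h k * measure M {\<omega> \<in> space M. Y \<omega> = k})"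
    using sets by simp
qed

text \<open>Fubini turns the mean cost along the random path into a time integral against the
  marginal laws \<open>p\<close>, which are what the forward equation describes. Finiteness of the
  state space supplies the dominating function \<open>\<Sum>k\<in>UNIV. \<bar>c s k\<bar>\<close>,
  independent of \<open>\<omega>\<close>.\<close>

lemma expectation_time_integral:
  fixes Y :: "real \<Rightarrow> 'w \<Rightarrow> 'i::finite" and c :: "real \<Rightarrow> 'i \<Rightarrow> real"
  assumes prob: "prob_space M"
    and Y: "(\<lambda>x. Y (fst x) (snd x)) \<in> lebesgue_on {0..T} \<Otimes>\<^sub>M M \<rightarrow>\<^sub>M count_space UNIV"
    and c: "\<And>k. integrable (lebesgue_on {0..T}) (\<lambda>s. c s k)"
  defines "p \<equiv> \<lambda>s k. measure M {\<omega> \<in> space M. Y s \<omega> = k}"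
  shows "\<omega> \<in> space M \<Longrightarrow> integrable (lebesgue_on {0..T}) (\<lambda>s. c s (Y s \<omega>))"
    and "(\<lambda>s. p s k) \<in> borel_measurable (lebesgue_on {0..T})"
    and "integrable M (\<lambda>\<omega>. \<integral>s. c s (Y s \<omega>) \<partial>lebesgue_on {0..T})"
    and "(\<integral>\<omega>. \<integral>s. c s (Y s \<omega>) \<partial>lebesgue_on {0..T} \<partial>M) =
      (\<integral>s. (\<Sum>k\<in>UNIV. c s k * p s k) \<partial>lebesgue_on {0..T})"
proof -
  let ?N = "lebesgue_on {0..T}"
  interpret M: prob_space M by (rule prob)
  interpret N: finite_measure ?N by (rule finite_measure_lebesgue_on_interval)
  interpret P: pair_sigma_finite ?N M ..
  have Ys: "Y s \<in> M \<rightarrow>\<^sub>M count_space UNIV" if "s \<in> {0..T}" for s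
    using measurable_compose[OF measurable_Pair1' Y, of s] that by simp
  have Y\<omega>: "(\<lambda>s. Y s \<omega>) \<in> ?N \<rightarrow>\<^sub>M count_space UNIV" if "\<omega> \<in> space M" for \<omega>
    using measurable_compose[OF measurable_Pair2' Y, of \<omega>] that by simp
  have c_meas: "(\<lambda>s. c s k) \<in> borel_measurable ?N" for k
    using c by auto
  have dom: "\<bar>c s (Y s \<omega>)\<bar> \<le> (\<Sum>k\<in>UNIV. \<bar>c s k\<bar>)" for s \<omega>
    by (rule member_le_sum) auto
  show int_\<omega>: "integrable ?N (\<lambda>s. c s (Y s \<omega>))" if "\<omega> \<in> space M" for \<omega>
  proof (rule Bochner_Integration.integrable_bound)
    show "integrable ?N (\<lambda>s. \<Sum>k\<in>UNIV. \<bar>c s k\<bar>)"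
      using c by auto
    show "(\<lambda>s. c s (Y s \<omega>)) \<in> borel_measurable ?N"
      by (rule measurable_compose_countable[OF c_meas Y\<omega>[OF that]])
  qed (use dom in \<open>auto intro: order_trans[OF _ abs_ge_self]\<close>)
  have exp_eq: "(\<integral>\<omega>. h (Y s \<omega>) \<partial>M) = (\<Sum>k\<in>UNIV. h k * p s k)" if "s \<in> {0..T}" for h s
    unfolding p_def by (rule expectation_finite_range(2)[OF prob Ys[OF that]])
  have p_meas: "(\<lambda>s. p s k) \<in> borel_measurable ?N" for k
  proof -
    have "(\<lambda>s. \<integral>\<omega>. (indicator {k} (Y s \<omega>) :: real) \<partial>M) \<in> borel_measurable ?N"
    proof (rule M.borel_measurable_lebesgue_integral)
      show "(\<lambda>(s, \<omega>). indicator {k} (Y s \<omega>) :: real) \<in> borel_measurable (?N \<Otimes>\<^sub>M M)"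
        using measurable_compose[OF Y, of "indicator {k} :: _ \<Rightarrow> real" borel]
        by (simp add: case_prod_unfold)
    qed
    moreover have "(\<lambda>s. \<integral>\<omega>. (indicator {k} (Y s \<omega>) :: real) \<partial>M) \<in> borel_measurable ?N \<longleftrightarrow>
        (\<lambda>s. p s k) \<in> borel_measurable ?N"
    proof (intro measurable_cong)
      fix s assume "s \<in> space ?N"
      then show "(\<integral>\<omega>. (indicator {k} (Y s \<omega>) :: real) \<partial>M) = p s k"
        using exp_eq[of s "indicator {k}"] by (simp add: indicator_def sum.delta)
    qed
    ultimately show ?thesis
      by simp
  qed
  then show "(\<lambda>s. p s k) \<in> borel_measurable ?N" .
  let ?f = "\<lambda>x. c (fst x) (Y (fst x) (snd x))"
  have f_int: "integrable (?N \<Otimes>\<^sub>M M) ?f"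
  proof (rule P.Fubini_integrable)
    show "?f \<in> borel_measurable (?N \<Otimes>\<^sub>M M)"
      by (rule measurable_compose_countable[OF measurable_compose[OF measurable_fst c_meas] Y])
    have eq: "(\<integral>\<omega>. norm (?f (s, \<omega>)) \<partial>M) = (\<Sum>k\<in>UNIV. \<bar>c s k\<bar> * p s k)" if "s \<in> space ?N" for s
      using exp_eq[of s "\<lambda>k. \<bar>c s k\<bar>"] that by simp
    have "integrable ?N (\<lambda>s. \<Sum>k\<in>UNIV. \<bar>c s k\<bar> * p s k)"
    proof (rule Bochner_Integration.integrable_bound)
      show "integrable ?N (\<lambda>s. \<Sum>k\<in>UNIV. \<bar>c s k\<bar>)"
        using c by auto
      show "(\<lambda>s. \<Sum>k\<in>UNIV. \<bar>c s k\<bar> * p s k) \<in> borel_measurable ?N"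
        using c_meas p_meas by measurable
      have "(\<Sum>k\<in>UNIV. \<bar>c s k\<bar> * p s k) \<le> (\<Sum>k\<in>UNIV. \<bar>c s k\<bar>)" for s
        unfolding p_def by (intro sum_mono mult_left_le) auto
      then show "AE s in ?N. norm (\<Sum>k\<in>UNIV. \<bar>c s k\<bar> * p s k) \<le> norm (\<Sum>k\<in>UNIV. \<bar>c s k\<bar>)"
        by (simp add: sum_nonneg p_def)
    qed
    moreover have "integrable ?N (\<lambda>s. \<integral>\<omega>. norm (?f (s, \<omega>)) \<partial>M) \<longleftrightarrow>
        integrable ?N (\<lambda>s. \<Sum>k\<in>UNIV. \<bar>c s k\<bar> * p s k)"
      by (intro Bochner_Integration.integrable_cong refl eq)
    ultimately show "integrable ?N (\<lambda>s. \<integral>\<omega>. norm (?f (s, \<omega>)) \<partial>M)"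
      by simp
    show "AE s in ?N. integrable M (\<lambda>\<omega>. ?f (s, \<omega>))"
      using expectation_finite_range(1)[OF prob Ys] by (intro AE_I2) simp
  qed
  show "integrable M (\<lambda>\<omega>. \<integral>s. c s (Y s \<omega>) \<partial>?N)"
    using P.integrable_snd[of "\<lambda>s \<omega>. c s (Y s \<omega>)"] f_int by (simp add: case_prod_unfold)
  have "(\<integral>\<omega>. \<integral>s. c s (Y s \<omega>) \<partial>?N \<partial>M) = (\<integral>s. \<integral>\<omega>. c s (Y s \<omega>) \<partial>M \<partial>?N)"
    using P.Fubini_integral[of "\<lambda>s \<omega>. c s (Y s \<omega>)"] f_int by (simp add: case_prod_unfold)
  also have "\<dots> = (\<integral>s. (\<Sum>k\<in>UNIV. c s k * p s k) \<partial>?N)"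
    by (intro Bochner_Integration.integral_cong) (auto simp: exp_eq)
  finally show "(\<integral>\<omega>. \<integral>s. c s (Y s \<omega>) \<partial>?N \<partial>M) = (\<integral>s. (\<Sum>k\<in>UNIV. c s k * p s k) \<partial>?N)" .
qed

text \<open>Here \<open>m\<close> is merely an indefinite integral of \<open>h\<close> and may fail
  to be differentiable at some times. The product rule is replaced by Fubini on the triangle
  \<open>u \<le> s\<close>: integrating the kernel \<open>f\<close> over \<open>u\<close> produces
  \<open>m\<close>, integrating it over \<open>s\<close> produces discount factors.\<close>

lemma discounted_integration_by_parts:
  fixes h m :: "real \<Rightarrow> real"
  assumes T: "0 \<le> T" and h: "integrable (lebesgue_on {0..T}) h"
    and m: "\<And>t. t \<in> {0..T} \<Longrightarrow> (h has_integral (m t - c)) {0..t}"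
  shows "(\<integral>s. exp (- (r * s)) * (h s - r * m s) \<partial>lebesgue_on {0..T}) = exp (- (r * T)) * m T - c"
proof -
  let ?N = "lebesgue_on {0..T}"
  interpret N: finite_measure ?N by (rule finite_measure_lebesgue_on_interval)
  interpret P: pair_sigma_finite ?N ?N ..
  have cont_integrable: "integrable ?N f" if "continuous_on {0..T} f" for f :: "real \<Rightarrow> real"
    using absolutely_integrable_continuous_real[OF that] by (rule absolutely_integrable_imp_integrable) simp
  have lborel_id: "(\<lambda>s. s) \<in> borel_measurable ?N"
    by (intro measurable_restrict_space1 measurable_completion) simp
  have integral_eq: "integral\<^sup>L ?N f = integral {0..T} f" if "integrable ?N f" for f :: "real \<Rightarrow> real"
    using that by (intro lebesgue_integral_eq_integral) auto
  \<comment> \<open>Minus the derivative of the discount factor, so that its integral over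
    \<open>{u..T}\<close> is a difference of discount factors.\<close>
  define e where "e s = r * exp (- (r * s))" for s
  have e_cont: "continuous_on A e" for A
    unfolding e_def by (intro continuous_intros)
  have "bounded (e ` {0..T})"
    by (intro compact_imp_bounded compact_continuous_image e_cont) simp
  then obtain K where "\<forall>x \<in> e ` {0..T}. norm x \<le> K"
    unfolding bounded_iff by blast
  then have K: "\<bar>e s\<bar> \<le> K" if "s \<in> {0..T}" for s
    using that by simp
  define f where "f s u = (if u \<le> s then e s * h u else 0)" for s u
  have f_int: "integrable (?N \<Otimes>\<^sub>M ?N) (\<lambda>(s, u). f s u)"
  proof (rule Bochner_Integration.integrable_bound)
    have h_meas: "(\<lambda>x. K * h (snd x)) \<in> borel_measurable (?N \<Otimes>\<^sub>M ?N)"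
      using h by measurable
    then show "integrable (?N \<Otimes>\<^sub>M ?N) (\<lambda>x. K * h (snd x))"
      by (rule P.Fubini_integrable) (use h in auto)
    have [measurable]: "e \<in> borel_measurable ?N" "h \<in> borel_measurable ?N"
      using cont_integrable[OF e_cont] h by auto
    note [measurable] = lborel_id
    have [measurable]: "fst \<in> borel_measurable (?N \<Otimes>\<^sub>M ?N)" "snd \<in> borel_measurable (?N \<Otimes>\<^sub>M ?N)"
      using measurable_compose[OF measurable_fst lborel_id] measurable_compose[OF measurable_snd lborel_id]
      by auto
    show "(\<lambda>(s, u). f s u) \<in> borel_measurable (?N \<Otimes>\<^sub>M ?N)"
      unfolding f_def case_prod_unfold by measurable
    show "AE x in ?N \<Otimes>\<^sub>M ?N. norm (case x of (s, u) \<Rightarrow> f s u) \<le> norm (K * h (snd x))"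
    proof (rule AE_I2)
      fix x assume "x \<in> space (?N \<Otimes>\<^sub>M ?N)"
      then have "\<bar>e (fst x)\<bar> \<le> \<bar>K\<bar>"
        using K[of "fst x"] by (auto simp: space_pair_measure)
      then show "norm (case x of (s, u) \<Rightarrow> f s u) \<le> norm (K * h (snd x))"
        by (auto simp: f_def case_prod_unfold abs_mult intro: mult_right_mono)
    qed
  qed
  have inner_u: "(\<integral>u. f s u \<partial>?N) = e s * (m s - c)" if s: "s \<in> {0..T}" for s
  proof -
    have int: "integrable ?N (\<lambda>u. if u \<in> {0..s} then h u else 0)"
    proof (rule Bochner_Integration.integrable_bound[OF h])
      note [measurable] = lborel_id
      have [measurable]: "h \<in> borel_measurable ?N"
        using h by auto
      show "(\<lambda>u. if u \<in> {0..s} then h u else 0) \<in> borel_measurable ?N"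
        unfolding atLeastAtMost_iff by measurable
    qed auto
    have "(\<integral>u. f s u \<partial>?N) = (\<integral>u. e s * (if u \<in> {0..s} then h u else 0) \<partial>?N)"
      by (intro Bochner_Integration.integral_cong) (auto simp: f_def)
    also have "\<dots> = e s * integral {0..T} (\<lambda>u. if u \<in> {0..s} then h u else 0)"
      using integral_eq[OF int] by simp
    also have "integral {0..T} (\<lambda>u. if u \<in> {0..s} then h u else 0) = integral {0..s} h"
      using integral_restrict_Int[of "{0..T}" "{0..s}" h] s by (simp only: Int_absorb2 Int_absorb1 atLeastatMost_subset_iff atLeastAtMost_iff order_refl simp_thms)
    also have "integral {0..s} h = m s - c"
      by (rule integral_unique[OF m[OF s]])
    finally show ?thesis .
  qed
  have e_integral: "integral {u..T} e = exp (- (r * u)) - exp (- (r * T))" if "u \<in> {0..T}" for u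
  proof (rule integral_unique)
    have "((\<lambda>s. - exp (- (r * s))) has_real_derivative e s) (at s within {u..T})" for s
      unfolding e_def by (auto intro!: derivative_eq_intros)
    then have "(e has_integral (- exp (- (r * T)) - - exp (- (r * u)))) {u..T}"
      using that by (intro fundamental_theorem_of_calculus)
        (auto simp only: has_real_derivative_iff_has_vector_derivative atLeastAtMost_iff)
    then show "(e has_integral (exp (- (r * u)) - exp (- (r * T)))) {u..T}"
      by simp
  qed
  have inner_s: "(\<integral>s. f s u \<partial>?N) = (exp (- (r * u)) - exp (- (r * T))) * h u"
    if u: "u \<in> {0..T}" for u
  proof -
    have int: "integrable ?N (\<lambda>s. if s \<in> {u..T} then e s else 0)"
    proof (rule Bochner_Integration.integrable_bound[OF cont_integrable[OF e_cont]])
      note [measurable] = lborel_id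
      have [measurable]: "e \<in> borel_measurable ?N"
        using cont_integrable[OF e_cont] by auto
      show "(\<lambda>s. if s \<in> {u..T} then e s else 0) \<in> borel_measurable ?N"
        unfolding atLeastAtMost_iff by measurable
    qed auto
    have "(\<integral>s. f s u \<partial>?N) = (\<integral>s. (if s \<in> {u..T} then e s else 0) * h u \<partial>?N)"
      by (intro Bochner_Integration.integral_cong) (auto simp: f_def)
    also have "\<dots> = integral {0..T} (\<lambda>s. if s \<in> {u..T} then e s else 0) * h u"
      using integral_eq[OF int] by simp
    also have "integral {0..T} (\<lambda>s. if s \<in> {u..T} then e s else 0) = integral {u..T} e"
      using integral_restrict_Int[of "{0..T}" "{u..T}" e] u by (simp only: Int_absorb2 Int_absorb1 atLeastatMost_subset_iff atLeastAtMost_iff order_refl simp_thms)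
    finally show ?thesis
      by (simp add: e_integral[OF u])
  qed
  have "continuous_on {0..T} (\<lambda>t. integral {0..t} h + c)"
    using m[of T] T by (intro continuous_intros indefinite_integral_continuous_1) auto
  then have m_cont: "continuous_on {0..T} m"
    by (rule continuous_on_eq) (use integral_unique[OF m] in simp)
  have int_eh: "integrable ?N (\<lambda>s. exp (- (r * s)) * h s)"
  proof -
    have "(\<lambda>s. exp (- (r * s)) * h s) absolutely_integrable_on {0..T}"
    proof (rule absolutely_integrable_bounded_measurable_product_real)
      show "(\<lambda>s. exp (- (r * s))) \<in> borel_measurable ?N"
        by (intro borel_measurable_integrable cont_integrable continuous_intros)
      show "bounded ((\<lambda>s. exp (- (r * s))) ` {0..T})"
        by (intro compact_imp_bounded compact_continuous_image continuous_intros) simp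
      show "h absolutely_integrable_on {0..T}"
        using h by (simp add: integrable_restrict_space set_integrable_def)
    qed simp
    then show ?thesis
      by (rule absolutely_integrable_imp_integrable) simp
  qed
  have int_em: "integrable ?N (\<lambda>s. e s * (m s - c))"
    by (intro cont_integrable continuous_intros e_cont m_cont)
  have int_e: "integrable ?N (\<lambda>s. e s * c)"
    by (intro cont_integrable continuous_intros e_cont)
  have "(\<integral>s. e s * (m s - c) \<partial>?N) = (\<integral>s. \<integral>u. f s u \<partial>?N \<partial>?N)"
    by (intro Bochner_Integration.integral_cong) (auto simp: inner_u)
  also have "\<dots> = (\<integral>u. \<integral>s. f s u \<partial>?N \<partial>?N)"
    by (rule P.Fubini_integral[OF f_int, symmetric])
  also have "\<dots> = (\<integral>u. exp (- (r * u)) * h u - exp (- (r * T)) * h u \<partial>?N)"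
    by (intro Bochner_Integration.integral_cong) (auto simp: inner_s algebra_simps)
  also have "\<dots> = (\<integral>u. exp (- (r * u)) * h u \<partial>?N) - exp (- (r * T)) * (\<integral>u. h u \<partial>?N)"
    using int_eh h by simp
  also have "(\<integral>u. h u \<partial>?N) = m T - c"
    using integral_eq[OF h] m[of T] T by (simp add: integral_unique)
  finally have 1: "(\<integral>s. e s * (m s - c) \<partial>?N) =
      (\<integral>u. exp (- (r * u)) * h u \<partial>?N) - exp (- (r * T)) * (m T - c)" .
  have 2: "(\<integral>s. e s * c \<partial>?N) = (1 - exp (- (r * T))) * c"
    using integral_eq[OF cont_integrable[OF e_cont]] e_integral[of 0] T by simp
  have "(\<integral>s. exp (- (r * s)) * (h s - r * m s) \<partial>?N) =
      (\<integral>s. exp (- (r * s)) * h s - e s * (m s - c) - e s * c \<partial>?N)"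
    by (intro Bochner_Integration.integral_cong) (auto simp: e_def algebra_simps)
  also have "\<dots> = (\<integral>s. exp (- (r * s)) * h s \<partial>?N) - (\<integral>s. e s * (m s - c) \<partial>?N) - (\<integral>s. e s * c \<partial>?N)"
    using int_eh int_em int_e by simp
  finally show ?thesis
    unfolding 1 2 by (simp add: algebra_simps)
qed

section \<open>Law and payoff of the controlled chain\<close>

text \<open>
  Conditioning on time \<open>0\<close> identifies the law of the chain with the row of the transition
  function at its deterministic starting point.
\<close>

lemma markov_chain_forward_equation:
  fixes V :: "'i::finite \<Rightarrow> 'i set" and w :: "'i \<Rightarrow> real"
  assumes irrefl: "\<And>k. k \<notin> V k"
    and prob: "prob_space M" and filtr: "usual_filtration M F"
    and chain: "markov_chain_with_rates M F V 0 T i a Y"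
    and s: "0 \<le> s" "s \<le> T"
  defines "p \<equiv> \<lambda>s k. measure M {\<omega> \<in> space M. Y s \<omega> = k}"
  shows "((\<lambda>u. \<Sum>k\<in>UNIV. p u k * (\<Sum>j\<in>V k. a u k j * (w j - w k)))
            has_integral ((\<Sum>k\<in>UNIV. p s k * w k) - w i)) {0..s}"
proof -
  interpret prob_space M by (rule prob)
  note chain' = chain[unfolded markov_chain_with_rates_def]
  note start = chain'[THEN conjunct2, THEN conjunct2, THEN conjunct1]
  from chain'[THEN conjunct2, THEN conjunct2, THEN conjunct2]
  obtain P where P': "transition_function V 0 T a P \<and> (\<forall>s s' j. 0 \<le> s \<longrightarrow> s \<le> s' \<longrightarrow> s' \<le> T \<longrightarrow>
      (AE \<omega> in M. real_cond_exp M (F s) (indicator {\<omega>\<in>space M. Y s' \<omega> = j}) \<omega> = P s s' (Y s \<omega>) j))"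
    by (rule exE)
  note P = P'[THEN conjunct1]
  have cond: "AE \<omega> in M. real_cond_exp M (F s) (indicator {\<omega>\<in>space M. Y s' \<omega> = j}) \<omega> = P s s' (Y s \<omega>) j"
    if "0 \<le> s" "s \<le> s'" "s' \<le> T" for s s' j
    using P'[THEN conjunct2] that by simp
  have sub: "subalgebra M (F u)" if "0 \<le> u" for u
    using filtr[unfolded usual_filtration_def, THEN conjunct1] that by simp
  have Y: "Y u \<in> M \<rightarrow>\<^sub>M count_space UNIV" if "0 \<le> u" "u \<le> T" for u
    using that chain'[THEN conjunct1, THEN bspec, of u]
    by (intro measurable_from_subalg[OF sub]) simp_all
  have p_eq: "p u k = P 0 u i k" if u: "0 \<le> u" "u \<le> T" for u k
  proof -
    interpret fin: finite_measure_subalgebra M "F 0"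
      by unfold_locales (rule sub, simp)
    let ?A = "{\<omega> \<in> space M. Y u \<omega> = k}"
    have A: "?A \<in> sets M"
      using Y[OF u] by measurable
    then have int: "integrable M (indicator ?A :: _ \<Rightarrow> real)"
      by (intro integrable_real_indicator) (auto simp: emeasure_eq_measure)
    have "p u k = (\<integral>\<omega>. indicator ?A \<omega> \<partial>M)"
      using A by (simp add: p_def)
    also have "\<dots> = (\<integral>\<omega>. real_cond_exp M (F 0) (indicator ?A) \<omega> \<partial>M)"
      by (rule fin.real_cond_exp_int(2)[OF int, symmetric])
    also have "\<dots> = (\<integral>\<omega>. P 0 u i k \<partial>M)"
    proof (rule integral_cong_AE)
      show "AE \<omega> in M. real_cond_exp M (F 0) (indicator ?A) \<omega> = P 0 u i k"
        using cond[OF order_refl u, of k] start by eventually_elim simp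
      show "real_cond_exp M (F 0) (indicator ?A) \<in> borel_measurable M"
        by simp
    qed simp
    finally show ?thesis
      by (simp add: prob_space)
  qed
  have "((\<lambda>u. \<Sum>l\<in>UNIV. P 0 u i l * generator V (a u) l j) has_integral
      (P 0 s i j - (if j = i then 1 else 0))) {0..s}" for j
    using P[unfolded transition_function_def, rule_format, of 0 s i] s by simp
  then have "((\<lambda>u. \<Sum>j\<in>UNIV. w j * (\<Sum>l\<in>UNIV. P 0 u i l * generator V (a u) l j)) has_integral
      (\<Sum>j\<in>UNIV. w j * (P 0 s i j - (if j = i then 1 else 0)))) {0..s}"
    by (intro has_integral_sum has_integral_mult_right) auto
  also have "(\<Sum>j\<in>UNIV. w j * (P 0 s i j - (if j = i then 1 else 0))) =
      (\<Sum>k\<in>UNIV. p s k * w k) - w i"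
    using p_eq s
    by (simp add: algebra_simps sum_subtractf if_distrib[of "\<lambda>x. w _ * x"] cong: if_cong)
  finally show ?thesis
  proof (rule has_integral_eq[rotated])
    fix u assume u: "u \<in> {0..s}"
    \<comment> \<open>Summed against \<open>w\<close>, the diagonal entry of the generator turns
      target values into increments \<open>w j - w l\<close>. That no node is its own neighbour
      keeps the diagonal entry apart from the jump rates.\<close>
    have gen: "(\<Sum>j\<in>UNIV. generator V (a u) l j * w j) = (\<Sum>j\<in>V l. a u l j * (w j - w l))" for l
    proof -
      have "(\<Sum>j\<in>UNIV. generator V (a u) l j * w j) =
          (\<Sum>j\<in>UNIV. (if j = l then - (\<Sum>j\<in>V l. a u l j) * w l else 0) +
            (if j \<in> V l then a u l j * w j else 0))"
        using irrefl by (intro sum.cong) (auto simp: generator_def)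
      also have "\<dots> = - (\<Sum>j\<in>V l. a u l j) * w l + (\<Sum>j\<in>V l. a u l j * w j)"
        by (simp add: sum.distrib sum.If_cases)
      also have "\<dots> = (\<Sum>j\<in>V l. a u l j * (w j - w l))"
        by (simp add: algebra_simps sum_subtractf sum_distrib_left sum_distrib_right)
      finally show ?thesis .
    qed
    have "(\<Sum>j\<in>UNIV. w j * (\<Sum>l\<in>UNIV. P 0 u i l * generator V (a u) l j)) =
        (\<Sum>j\<in>UNIV. \<Sum>l\<in>UNIV. P 0 u i l * (generator V (a u) l j * w j))"
      by (simp add: sum_distrib_left mult_ac)
    also have "\<dots> = (\<Sum>l\<in>UNIV. \<Sum>j\<in>UNIV. P 0 u i l * (generator V (a u) l j * w j))"
      by (rule sum.swap)
    also have "\<dots> = (\<Sum>k\<in>UNIV. p u k * (\<Sum>j\<in>V k. a u k j * (w j - w k)))"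
      using u s p_eq[of u] by (simp add: sum_distrib_left[symmetric] gen)
    finally show "(\<Sum>j\<in>UNIV. w j * (\<Sum>l\<in>UNIV. P 0 u i l * generator V (a u) l j)) =
        (\<Sum>k\<in>UNIV. p u k * (\<Sum>j\<in>V k. a u k j * (w j - w k)))" .
  qed
qed

text \<open>Dynkin's formula. The discounted cost \<open>l\<close> is the mean rate of change of the
  discounted \<open>w\<close> along the chain, so its time integral reduces to boundary terms, and
  the payoff is \<open>w i\<close> up to the discounted terminal mismatch between \<open>g\<close>
  and \<open>w\<close>.\<close>

lemma expected_payoff_linear_cost:
  fixes V :: "'i::finite \<Rightarrow> 'i set" and w g :: "'i \<Rightarrow> real"
  assumes irrefl: "\<And>k. k \<notin> V k"
    and prob: "prob_space M" and filtr: "usual_filtration M F"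
    and chain: "markov_chain_with_rates M F V 0 T i a Y"
    and a: "a \<in> admissible V 0 T" and T: "0 \<le> T" and r: "0 \<le> r"
  defines "l \<equiv> \<lambda>s k. (\<Sum>j\<in>V k. a s k j * (w j - w k)) - r * w k"
  shows "ereal_integral M (\<lambda>\<omega>.
      - ereal_integral (lebesgue_on {0..T}) (\<lambda>s. ereal (exp (- r * (s - 0))) * ereal (l s (Y s \<omega>)))
      + ereal (exp (- r * (T - 0)) * g (Y T \<omega>))) =
    ereal (w i + exp (- (r * T)) *
      (\<Sum>k\<in>UNIV. measure M {\<omega> \<in> space M. Y T \<omega> = k} * (g k - w k)))"
proof -
  let ?N = "lebesgue_on {0..T}"
  interpret M: prob_space M by (rule prob)
  interpret N: finite_measure ?N by (rule finite_measure_lebesgue_on_interval)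
  define p where "p s k = measure M {\<omega> \<in> space M. Y s \<omega> = k}" for s k
  note chain' = chain[unfolded markov_chain_with_rates_def]
  have Y: "Y u \<in> M \<rightarrow>\<^sub>M count_space UNIV" if "u \<in> {0..T}" for u
  proof (rule measurable_from_subalg)
    show "subalgebra M (F u)"
      using filtr[unfolded usual_filtration_def, THEN conjunct1] that by simp
    show "Y u \<in> F u \<rightarrow>\<^sub>M count_space UNIV"
      using chain'[THEN conjunct1] that by blast
  qed
  have rc: "\<forall>\<^sub>F u in at_right s. Y u \<omega> = Y s \<omega>" if "\<omega> \<in> space M" "s \<in> {0..<T}" for \<omega> s
    using chain'[THEN conjunct2, THEN conjunct1] that by blast
  note YN = right_continuous_jointly_measurable[of T Y M, OF Y rc]
  define A where "A s k = (\<Sum>j\<in>V k. a s k j * (w j - w k))" for s k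
  have A_int: "integrable ?N (\<lambda>s. A s k)" for k
    unfolding A_def
  proof (intro Bochner_Integration.integrable_sum integrable_mult_left absolutely_integrable_imp_integrable)
    fix j assume "j \<in> V k"
    then show "(\<lambda>s. a s k j) absolutely_integrable_on {0..T}"
      using a unfolding admissible_def by simp
  qed simp
  have exp_meas: "(\<lambda>s. exp (- (r * s))) \<in> borel_measurable ?N"
    by (intro borel_measurable_integrable absolutely_integrable_imp_integrable
        absolutely_integrable_continuous_real continuous_intros) simp
  define c where "c s k = exp (- (r * s)) * l s k" for s k
  have l_int: "integrable ?N (\<lambda>s. l s k)" for k
    unfolding l_def using A_int[of k, unfolded A_def] by simp
  have c_int: "integrable ?N (\<lambda>s. c s k)" for k
  proof (rule Bochner_Integration.integrable_bound[OF l_int[of k]])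
    show "(\<lambda>s. c s k) \<in> borel_measurable ?N"
      unfolding c_def using l_int by (intro borel_measurable_times exp_meas) auto
    show "AE s in ?N. norm (c s k) \<le> norm (l s k)"
      using r by (intro AE_I2) (auto simp: c_def abs_mult intro!: mult_left_le_one_le)
  qed
  note E = expectation_time_integral[where c = c, OF prob YN c_int, folded p_def]
  define h where "h s = (\<Sum>k\<in>UNIV. p s k * A s k)" for s
  have h_int: "integrable ?N h"
    unfolding h_def
  proof (rule Bochner_Integration.integrable_sum)
    fix k
    show "integrable ?N (\<lambda>s. p s k * A s k)"
    proof (rule Bochner_Integration.integrable_bound[OF A_int[of k]])
      show "(\<lambda>s. p s k * A s k) \<in> borel_measurable ?N"
        using E(2)[of k] A_int[of k] by (intro borel_measurable_times) auto
      show "AE s in ?N. norm (p s k * A s k) \<le> norm (A s k)"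
        by (intro AE_I2) (auto simp: p_def abs_mult intro!: mult_left_le_one_le)
    qed
  qed
  define m where "m s = (\<Sum>k\<in>UNIV. p s k * w k)" for s
  have "(h has_integral (m t - w i)) {0..t}" if "t \<in> {0..T}" for t
    using markov_chain_forward_equation[OF irrefl prob filtr chain, of t w] that
    by (simp add: h_def[abs_def] m_def p_def A_def)
  from discounted_integration_by_parts[OF T h_int this, where r = r]
  have by_parts: "(\<integral>s. exp (- (r * s)) * (h s - r * m s) \<partial>?N) = exp (- (r * T)) * m T - w i" .
  have "c s k * p s k = exp (- (r * s)) * (p s k * A s k - r * (p s k * w k))" for s k
    by (simp add: c_def l_def A_def algebra_simps)
  then have "(\<Sum>k\<in>UNIV. c s k * p s k) = exp (- (r * s)) * (h s - r * m s)" for s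
    by (simp add: h_def m_def sum_subtractf flip: sum_distrib_left)
  with E(4) by_parts
  have running: "(\<integral>\<omega>. \<integral>s. c s (Y s \<omega>) \<partial>?N \<partial>M) = exp (- (r * T)) * m T - w i"
    by simp
  have YT: "Y T \<in> M \<rightarrow>\<^sub>M count_space UNIV"
    using T by (intro Y) simp
  note terminal = expectation_finite_range[OF prob YT, of g, folded p_def]
  have "ereal_integral M (\<lambda>\<omega>.
      - ereal_integral ?N (\<lambda>s. ereal (exp (- r * (s - 0))) * ereal (l s (Y s \<omega>)))
      + ereal (exp (- r * (T - 0)) * g (Y T \<omega>))) =
    ereal_integral M (\<lambda>\<omega>. ereal (- (\<integral>s. c s (Y s \<omega>) \<partial>?N) + exp (- (r * T)) * g (Y T \<omega>)))"
  proof (rule ereal_integral_cong)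
    fix \<omega> assume "\<omega> \<in> space M"
    then have "ereal_integral ?N (\<lambda>s. ereal (c s (Y s \<omega>))) = ereal (\<integral>s. c s (Y s \<omega>) \<partial>?N)"
      by (intro ereal_integral_ereal E(1))
    then show "- ereal_integral ?N (\<lambda>s. ereal (exp (- r * (s - 0))) * ereal (l s (Y s \<omega>)))
        + ereal (exp (- r * (T - 0)) * g (Y T \<omega>)) =
      ereal (- (\<integral>s. c s (Y s \<omega>) \<partial>?N) + exp (- (r * T)) * g (Y T \<omega>))"
      by (simp add: c_def)
  qed
  also have "\<dots> = ereal (\<integral>\<omega>. - (\<integral>s. c s (Y s \<omega>) \<partial>?N) + exp (- (r * T)) * g (Y T \<omega>) \<partial>M)"
    using E(3) terminal(1) by (intro ereal_integral_ereal) simp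
  also have "(\<integral>\<omega>. - (\<integral>s. c s (Y s \<omega>) \<partial>?N) + exp (- (r * T)) * g (Y T \<omega>) \<partial>M) =
      - (exp (- (r * T)) * m T - w i) + exp (- (r * T)) * (\<Sum>k\<in>UNIV. g k * p T k)"
    using E(3) terminal by (simp add: running)
  also have "\<dots> = w i + exp (- (r * T)) * (\<Sum>k\<in>UNIV. p T k * (g k - w k))"
    by (simp add: m_def algebra_simps sum_subtractf)
  finally show ?thesis
    unfolding p_def .
qed

lemma expected_payoff_remainder:
  fixes Y :: "'w \<Rightarrow> 'i::finite"
  assumes "prob_space M" and Y: "Y \<in> M \<rightarrow>\<^sub>M count_space UNIV" and D: "\<And>k. \<bar>d k\<bar> \<le> D"
  shows "\<bar>\<Sum>k\<in>UNIV. measure M {\<omega> \<in> space M. Y \<omega> = k} * d k\<bar> \<le> D"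
proof -
  interpret prob_space M by fact
  let ?p = "\<lambda>k. measure M {\<omega> \<in> space M. Y \<omega> = k}"
  have one: "(\<Sum>k\<in>UNIV. ?p k) = 1"
    using expectation_finite_range(2)[OF assms(1) Y, of "\<lambda>_. 1"] by (simp add: prob_space)
  have "\<bar>\<Sum>k\<in>UNIV. ?p k * d k\<bar> \<le> (\<Sum>k\<in>UNIV. \<bar>?p k * d k\<bar>)"
    by (rule sum_abs)
  also have "\<dots> \<le> (\<Sum>k\<in>UNIV. ?p k * D)"
    using D by (intro sum_mono) (simp add: abs_mult mult_left_mono)
  finally show ?thesis
    using one by (simp add: sum_distrib_right[symmetric])
qed

text \<open>A dearer running cost lowers the payoff, so it suffices to compare \<open>L\<close>
  pointwise with the cost of the exact formula. The bound \<open>D\<close> controls the terminal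
  mismatch uniformly in the control.\<close>

lemma
  fixes V :: "'i::finite \<Rightarrow> 'i set" and w g :: "'i \<Rightarrow> real"
  assumes irrefl: "\<And>k. k \<notin> V k"
    and prob: "prob_space M" and filtr: "usual_filtration M F"
    and chain: "markov_chain_with_rates M F V 0 T i a Y"
    and a: "a \<in> admissible V 0 T" and T: "0 \<le> T" and r: "0 \<le> r"
    and D: "\<And>k. \<bar>g k - w k\<bar> \<le> D"
  defines "l \<equiv> \<lambda>s k. (\<Sum>j\<in>V k. a s k j * (w j - w k)) - r * w k"
  shows expected_payoff_upper:
      "(\<And>s k. s \<in> {0..T} \<Longrightarrow> ereal (l s k) \<le> L k (restrict (a s k) (V k))) \<Longrightarrow>
        expected_payoff M V L g T r 0 a Y \<le> ereal (w i + exp (- (r * T)) * D)"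
    and expected_payoff_lower:
      "(\<And>s k. s \<in> {0..T} \<Longrightarrow> L k (restrict (a s k) (V k)) \<le> ereal (l s k)) \<Longrightarrow>
        ereal (w i - exp (- (r * T)) * D) \<le> expected_payoff M V L g T r 0 a Y"
proof -
  let ?N = "lebesgue_on {0..T}"
  let ?I = "ereal_integral M (\<lambda>\<omega>.
      - ereal_integral ?N (\<lambda>s. ereal (exp (- r * (s - 0))) * ereal (l s (Y s \<omega>)))
      + ereal (exp (- r * (T - 0)) * g (Y T \<omega>)))"
  define S where "S = (\<Sum>k\<in>UNIV. measure M {\<omega> \<in> space M. Y T \<omega> = k} * (g k - w k))"
  have I: "?I = ereal (w i + exp (- (r * T)) * S)"
    unfolding l_def S_def
    by (rule expected_payoff_linear_cost[OF irrefl prob filtr chain a T r])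
  have "Y T \<in> M \<rightarrow>\<^sub>M count_space UNIV"
  proof (rule measurable_from_subalg)
    show "subalgebra M (F T)"
      using filtr[unfolded usual_filtration_def, THEN conjunct1] T by simp
    show "Y T \<in> F T \<rightarrow>\<^sub>M count_space UNIV"
      using chain[unfolded markov_chain_with_rates_def, THEN conjunct1] T by simp
  qed
  then have "\<bar>S\<bar> \<le> D"
    unfolding S_def using D by (rule expected_payoff_remainder[OF prob])
  then have "exp (- (r * T)) * S \<le> exp (- (r * T)) * D"
    and "exp (- (r * T)) * (- D) \<le> exp (- (r * T)) * S"
    by (intro mult_left_mono; simp)+
  then have "?I \<le> ereal (w i + exp (- (r * T)) * D)" "ereal (w i - exp (- (r * T)) * D) \<le> ?I"
    unfolding I by auto
  moreover have "expected_payoff M V L g T r 0 a Y \<le> ?I"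
    if "\<And>s k. s \<in> {0..T} \<Longrightarrow> ereal (l s k) \<le> L k (restrict (a s k) (V k))"
    unfolding expected_payoff_def
    using that
    by (intro ereal_integral_mono add_right_mono ereal_minus_le_minus[THEN iffD2]
        ereal_mult_left_mono) auto
  moreover have "?I \<le> expected_payoff M V L g T r 0 a Y"
    if "\<And>s k. s \<in> {0..T} \<Longrightarrow> L k (restrict (a s k) (V k)) \<le> ereal (l s k)"
    unfolding expected_payoff_def
    using that
    by (intro ereal_integral_mono add_right_mono ereal_minus_le_minus[THEN iffD2]
        ereal_mult_left_mono) auto
  ultimately show "(\<And>s k. s \<in> {0..T} \<Longrightarrow> ereal (l s k) \<le> L k (restrict (a s k) (V k))) \<Longrightarrow>
        expected_payoff M V L g T r 0 a Y \<le> ereal (w i + exp (- (r * T)) * D)"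
    and "(\<And>s k. s \<in> {0..T} \<Longrightarrow> L k (restrict (a s k) (V k)) \<le> ereal (l s k)) \<Longrightarrow>
        ereal (w i - exp (- (r * T)) * D) \<le> expected_payoff M V L g T r 0 a Y"
    by (meson order_trans)+
qed

text \<open>Since \<open>r * w k\<close> is the Hamiltonian at the differences of \<open>w\<close>,
  duality places the linear cost below \<open>L\<close> for every control, which caps the value.
  Near-maximisers of the Hamiltonian attain the cap up to any tolerance, and the terminal mismatch
  is discounted away as \<open>T\<close> grows.\<close>

lemma value_function_limit:
  fixes V :: "'i::finite \<Rightarrow> 'i set" and w :: "'i \<Rightarrow> real"
  assumes irrefl: "\<And>k. k \<notin> V k" and cost: "cost_functions V L"
    and prob: "prob_space M" and filtr: "usual_filtration M F"
    and chain: "\<And>T i a. 0 \<le> T \<Longrightarrow> a \<in> admissible V 0 T \<Longrightarrow>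
                  markov_chain_with_rates M F V 0 T i a (X 0 T i a)"
    and r: "0 < r" and w: "\<And>i. r * w i = hamiltonian V L i (\<lambda>j. w j - w i)"
    and lim: "((\<lambda>T. value_function M V L g X T r i 0) \<longlongrightarrow> ereal u) at_top"
  shows "u = w i"
proof (rule antisym)
  have decay: "((\<lambda>T. exp (- (r * T))) \<longlongrightarrow> 0) at_top"
  proof (rule filterlim_compose[OF exp_at_bot])
    show "filterlim (\<lambda>T. - (r * T)) at_bot at_top"
      using filterlim_tendsto_pos_mult_at_top[OF tendsto_const r filterlim_ident]
      by (simp add: filterlim_uminus_at_bot)
  qed
  show "u \<le> w i"
  proof -
    define D where "D = Max (range (\<lambda>k. \<bar>g k - w k\<bar>))"
    have D: "\<bar>g k - w k\<bar> \<le> D" for k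
      unfolding D_def by simp
    have "value_function M V L g X T r i 0 \<le> ereal (w i + exp (- (r * T)) * D)" if T: "0 \<le> T" for T
      unfolding value_function_def
    proof (rule SUP_least)
      fix a assume a: "a \<in> admissible V 0 T"
      show "expected_payoff M V L g T r 0 a (X 0 T i a) \<le> ereal (w i + exp (- (r * T)) * D)"
      proof (rule expected_payoff_upper[OF irrefl prob filtr chain[OF T a] a T _ D])
        fix s k assume s: "s \<in> {0..T}"
        have "restrict (a s k) (V k) \<in> V k \<rightarrow>\<^sub>E {0..}"
          using a s by (auto simp: admissible_def)
        from cost_ge_hamiltonian[OF cost this, of "\<lambda>j. w j - w k"]
        show "ereal ((\<Sum>j\<in>V k. a s k j * (w j - w k)) - r * w k) \<le> L k (restrict (a s k) (V k))"
          by (simp add: w restrict_def)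
      qed (use r in simp)
    qed
    then have "\<forall>\<^sub>F T in at_top. value_function M V L g X T r i 0 \<le> ereal (w i + exp (- (r * T)) * D)"
      by (rule eventually_at_top_linorderI)
    moreover have "((\<lambda>T. ereal (w i + exp (- (r * T)) * D)) \<longlongrightarrow> ereal (w i + 0 * D)) at_top"
      by (intro tendsto_ereal tendsto_intros decay)
    ultimately have "ereal u \<le> ereal (w i + 0 * D)"
      using lim by (intro tendsto_le[OF trivial_limit_at_top_linorder])
    then show ?thesis
      by simp
  qed
  show "w i \<le> u"
  proof (rule field_le_epsilon)
    fix e :: real assume e: "0 < e"
    with r have re: "0 < r * e"
      by simp
    \<comment> \<open>The tolerance \<open>r * e\<close> is exactly what shifting \<open>w\<close>
      down by \<open>e\<close> compensates: the differences stay the same while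
      \<open>- r * w k\<close> grows by \<open>r * e\<close>. The chosen rates then cost at most the
      linear cost of the shifted vector \<open>w'\<close>, so the exact formula applies to
      \<open>w'\<close> without an error term.\<close>
    have "\<forall>k. \<exists>x. x \<in> V k \<rightarrow>\<^sub>E {0..} \<and>
        L k x \<le> ereal ((\<Sum>j\<in>V k. x j * (w j - w k)) - r * w k + r * e)"
      using cost_near_hamiltonian[OF cost re, where p = "\<lambda>j. w j - w k" and i = k for k]
      unfolding w Bex_def by (rule allI)
    from choice[OF this] obtain b where b: "\<And>k. b k \<in> V k \<rightarrow>\<^sub>E {0..}"
      "\<And>k. L k (b k) \<le> ereal ((\<Sum>j\<in>V k. b k j * (w j - w k)) - r * w k + r * e)"
      by auto
    define a :: "'i rates" where "a = (\<lambda>_. b)"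
    define w' where "w' k = w k - e" for k
    define D where "D = Max (range (\<lambda>k. \<bar>g k - w' k\<bar>))"
    have D: "\<bar>g k - w' k\<bar> \<le> D" for k
      unfolding D_def by simp
    have "ereal (w' i - exp (- (r * T)) * D) \<le> value_function M V L g X T r i 0" if T: "0 \<le> T" for T
    proof -
      have a: "a \<in> admissible V 0 T"
        using b(1) by (auto simp: admissible_def a_def PiE_iff intro: absolutely_integrable_on_const)
      have "ereal (w' i - exp (- (r * T)) * D) \<le> expected_payoff M V L g T r 0 a (X 0 T i a)"
      proof (rule expected_payoff_lower[OF irrefl prob filtr chain[OF T a] a T _ D])
        fix s k
        have "restrict (a s k) (V k) = b k"
          using b(1)[of k] by (simp add: a_def PiE_restrict)
        then show "L k (restrict (a s k) (V k)) \<le>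
            ereal ((\<Sum>j\<in>V k. a s k j * (w' j - w' k)) - r * w' k)"
          using b(2)[of k] by (simp add: a_def w'_def algebra_simps)
      qed (use r in simp)
      also have "\<dots> \<le> value_function M V L g X T r i 0"
        unfolding value_function_def by (rule SUP_upper[OF a])
      finally show ?thesis .
    qed
    then have "\<forall>\<^sub>F T in at_top. ereal (w' i - exp (- (r * T)) * D) \<le> value_function M V L g X T r i 0"
      by (rule eventually_at_top_linorderI)
    moreover have "((\<lambda>T. ereal (w' i - exp (- (r * T)) * D)) \<longlongrightarrow> ereal (w' i - 0 * D)) at_top"
      by (intro tendsto_ereal tendsto_intros decay)
    ultimately have "ereal (w' i - 0 * D) \<le> ereal u"
      using lim by (intro tendsto_le[OF trivial_limit_at_top_linorder])
    then show "w i \<le> u + e"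
      by (simp add: w'_def)
  qed
qed

section \<open>Cooperative flows\<close>

text \<open>At a maximal coordinate the derivative is only known to be nonpositive. Subtracting a
  small slope, the same for all coordinates, leaves the maximal coordinate unchanged and makes its
  derivative strictly negative, so the maximum over all nodes and all times in \<open>{a..b}\<close>
  sits at \<open>a\<close>.\<close>

lemma max_principle:
  fixes z :: "'i::finite \<Rightarrow> real \<Rightarrow> real"
  assumes der: "\<And>i t. 0 \<le> t \<Longrightarrow> (z i has_real_derivative z' i t) (at t within {0..})"
    and max: "\<And>i t. 0 \<le> t \<Longrightarrow> (\<And>j. z j t \<le> z i t) \<Longrightarrow> z' i t \<le> 0"
    and init: "\<And>i. z i a \<le> c" and a: "0 \<le> a" "a \<le> b"
  shows "z i b \<le> c"
proof (rule field_le_epsilon)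
  fix e :: real assume "0 < e"
  \<comment> \<open>The added 1 covers the case \<open>a = b\<close>; the accumulated correction
    stays at most \<open>e\<close>.\<close>
  define \<epsilon> where "\<epsilon> = e / (b - a + 1)"
  have \<epsilon>: "0 < \<epsilon>" "\<epsilon> * (b - a) \<le> e"
    using \<open>0 < e\<close> a by (auto simp: \<epsilon>_def field_simps)
  define \<phi> where "\<phi> j t = z j t - \<epsilon> * (t - a)" for j t
  have cont: "continuous_on {a..b} (\<phi> j)" for j
  proof -
    have "continuous_on {0..} (z j)"
      using der by (intro DERIV_continuous_on) auto
    then have "continuous_on {a..b} (z j)"
      by (rule continuous_on_subset) (use a in auto)
    then show ?thesis
      unfolding \<phi>_def by (intro continuous_intros)
  qed
  have "\<exists>t\<in>{a..b}. \<forall>s\<in>{a..b}. \<phi> j s \<le> \<phi> j t" for j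
    using a by (intro continuous_attains_sup cont) auto
  then obtain T where T: "\<And>j. T j \<in> {a..b}" "\<And>j s. s \<in> {a..b} \<Longrightarrow> \<phi> j s \<le> \<phi> j (T j)"
    by metis
  have "Max (range (\<lambda>j. \<phi> j (T j))) \<in> range (\<lambda>j. \<phi> j (T j))"
    by (rule Max_in) auto
  then obtain k where "\<phi> k (T k) = Max (range (\<lambda>j. \<phi> j (T j)))"
    by (metis imageE)
  then have "\<phi> j (T j) \<le> \<phi> k (T k)" for j
    by simp
  with T have top: "\<phi> j s \<le> \<phi> k (T k)" if "s \<in> {a..b}" for j s
    using that order_trans by blast
  define t where "t = T k"
  have t: "a \<le> t" "t \<le> b"
    using T(1)[of k] by (auto simp: t_def)
  have "t = a"
  proof (rule ccontr)
    assume "t \<noteq> a"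
    with t have "a < t"
      by simp
    have "z j t \<le> z k t" for j
      using top[of t j] t by (simp add: t_def \<phi>_def)
    then have z'0: "z' k t \<le> 0"
      using max[of t k] a t by simp
    have "(z k has_real_derivative z' k t) (at t within {0..})"
      using der a t by simp
    \<comment> \<open>Only the past of \<open>t\<close> is inspected, since the maximum may sit at
      \<open>b\<close>: a negative derivative from the left makes some earlier value larger.\<close>
    then have "(z k has_real_derivative z' k t) (at t within {a..t})"
      by (rule DERIV_subset) (use a in auto)
    then have "(\<phi> k has_real_derivative z' k t - \<epsilon>) (at t within {a..t})"
      unfolding \<phi>_def by (auto intro!: derivative_eq_intros)
    moreover have "z' k t - \<epsilon> < 0"
      using z'0 \<epsilon> by simp
    ultimately obtain d where d: "0 < d"
      "\<And>h. 0 < h \<Longrightarrow> t - h \<in> {a..t} \<Longrightarrow> h < d \<Longrightarrow> \<phi> k t < \<phi> k (t - h)"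
      using has_real_derivative_neg_dec_left by metis
    define h where "h = min (d / 2) (t - a)"
    have "0 < h" "t - h \<in> {a..t}" "h < d" "t - h \<in> {a..b}"
      using d \<open>a < t\<close> t by (auto simp: h_def min_def)
    with d(2)[of h] top[of "t - h" k] show False
      by (simp add: t_def)
  qed
  have "z i b - \<epsilon> * (b - a) = \<phi> i b"
    by (simp add: \<phi>_def)
  also have "\<dots> \<le> \<phi> k (T k)"
    using a by (intro top) simp
  also have "\<dots> = z k a"
    using \<open>t = a\<close> by (simp add: \<phi>_def t_def)
  also have "\<dots> \<le> c"
    by (rule init)
  finally show "z i b \<le> c + e"
    using \<epsilon> by simp
qed

text \<open>
  A coordinate that is asymptotically maximal has an asymptotically vanishing derivative, since
  otherwise it would exceed the limit of the maximum shortly before or shortly after.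
\<close>

lemma cooperative_flow_converges:
  fixes F :: "'i::finite \<Rightarrow> real^'i \<Rightarrow> real" and Z :: "real \<Rightarrow> real^'i"
  assumes graph: "strongly_connected_graph V"
    and cont: "\<And>i. continuous_on UNIV (F i)"
    and max: "\<And>i x. (\<And>j. x $ j \<le> x $ i) \<Longrightarrow> F i x \<le> 0"
    and max_eq: "\<And>i j x. (\<And>j. x $ j \<le> x $ i) \<Longrightarrow> F i x = 0 \<Longrightarrow> j \<in> V i \<Longrightarrow> x $ j = x $ i"
    and min: "\<And>i x. (\<And>j. x $ i \<le> x $ j) \<Longrightarrow> 0 \<le> F i x"
    and der: "\<And>i t. 0 \<le> t \<Longrightarrow>
                ((\<lambda>t. Z t $ i) has_real_derivative F i (Z t)) (at t within {0..})"
  shows "\<exists>c. \<forall>i. ((\<lambda>t. Z t $ i) \<longlongrightarrow> c) at_top"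
proof -
  have below: "Z t $ i \<le> c" if "\<And>j. Z s $ j \<le> c" "0 \<le> s" "s \<le> t" for i s t c
    by (rule max_principle[where z = "\<lambda>i t. Z t $ i" and z' = "\<lambda>i t. F i (Z t)"])
      (use der max that in auto)
  \<comment> \<open>Negating the flow exchanges maxima and minima.\<close>
  have above: "c \<le> Z t $ i" if "\<And>j. c \<le> Z s $ j" "0 \<le> s" "s \<le> t" for i s t c
  proof -
    have "- (Z t $ i) \<le> - c"
      by (rule max_principle[where z = "\<lambda>i t. - (Z t $ i)" and z' = "\<lambda>i t. - F i (Z t)"])
        (use der min that in \<open>auto intro: DERIV_minus\<close>)
    then show ?thesis
      by simp
  qed
  define q where "q t = Max (range (\<lambda>i. Z t $ i))" for t
  have Z_le_q: "Z t $ i \<le> q t" for t i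
    unfolding q_def by simp
  have q_attained: "\<exists>i. Z t $ i = q t" for t
  proof -
    have "q t \<in> range (\<lambda>i. Z t $ i)"
      unfolding q_def by (rule Max_in) auto
    then show ?thesis
      by auto
  qed
  have q_antimono: "q t \<le> q s" if "0 \<le> s" "s \<le> t" for s t
    using q_attained[of t] below[OF Z_le_q that] by metis
  define m where "m = Min (range (\<lambda>i. Z 0 $ i))"
  have m_le: "m \<le> Z t $ i" if "0 \<le> t" for t i
    by (rule above[OF _ order_refl that]) (simp add: m_def)
  have bounded: "\<bar>Z t $ i\<bar> \<le> \<bar>m\<bar> + \<bar>q 0\<bar>" if "0 \<le> t" for t i
    using m_le[OF that, of i] Z_le_q[of t i] q_antimono[of 0 t] that by simp
  define R where "R = real CARD('i) * (\<bar>m\<bar> + \<bar>q 0\<bar>)"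
  have Z_cball: "Z t \<in> cball 0 R" if "0 \<le> t" for t
  proof -
    have "norm (Z t) \<le> (\<Sum>i\<in>UNIV. \<bar>Z t $ i\<bar>)"
      by (rule norm_le_l1_cart)
    also have "\<dots> \<le> R"
      unfolding R_def using bounded[OF that] by (intro sum_bounded_above) auto
    finally show ?thesis
      by simp
  qed
  define Q where "Q = (INF t\<in>{0..}. q t)"
  have q_bdd: "bdd_below (q ` {0..})"
    using order_trans[OF m_le Z_le_q] by (intro bdd_belowI[where m = m]) auto
  have Q_le: "Q \<le> q t" if "0 \<le> t" for t
    unfolding Q_def by (rule cINF_lower[OF q_bdd]) (use that in simp)
  have q_lim: "(q \<longlongrightarrow> Q) at_top"
  proof (rule order_tendstoI)
    fix x assume "x < Q"
    then show "\<forall>\<^sub>F t in at_top. x < q t"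
      using Q_le by (intro eventually_at_top_linorderI[of 0]) (metis less_le_trans)
  next
    fix x assume "Q < x"
    then obtain s where "0 \<le> s" "q s < x"
      unfolding Q_def using cINF_less_iff[OF _ q_bdd] by (metis atLeast_iff empty_iff order_refl)
    then show "\<forall>\<^sub>F t in at_top. q t < x"
      using q_antimono by (intro eventually_at_top_linorderI[of s]) (metis le_less_trans)
  qed
  \<comment> \<open>Sampling the orbit at integer times is enough to produce a limit point
    \<open>y\<close>.\<close>
  have "\<exists>y\<in>cball 0 R. \<exists>r::nat\<Rightarrow>nat. strict_mono r \<and> ((\<lambda>n. Z (real n)) \<circ> r) \<longlonglongrightarrow> y"
    using compact_cball[of "0::real^'i" R] Z_cball unfolding compact_def
    by (metis of_nat_0_le_iff)
  then obtain y r where r: "strict_mono (r::nat\<Rightarrow>nat)" and y: "(\<lambda>n. Z (real (r n))) \<longlonglongrightarrow> y"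
    by (auto simp: o_def)
  define T where "T n = real (r n)" for n
  have T: "filterlim T at_top sequentially"
    unfolding T_def using filterlim_compose[OF filterlim_real_sequentially filterlim_subseq[OF r]]
    by simp
  have y': "(\<lambda>n. Z (T n)) \<longlonglongrightarrow> y"
    using y by (simp add: T_def)
  have yj: "(\<lambda>n. Z (T n) $ j) \<longlonglongrightarrow> y $ j" for j
    using y' by (intro tendsto_intros)
  have qT: "(\<lambda>n. q (T n)) \<longlonglongrightarrow> Q"
    by (rule filterlim_compose[OF q_lim T])
  have y_le: "y $ j \<le> Q" for j
    by (rule LIMSEQ_le[OF yj qT]) (use Z_le_q in auto)
  have F_bdd: "\<exists>K. \<forall>x\<in>cball 0 R. \<forall>i. \<bar>F i x\<bar> \<le> K"
  proof -
    have "\<exists>K. \<forall>x\<in>cball 0 R. \<bar>F i x\<bar> \<le> K" for i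
    proof -
      have "compact (F i ` cball 0 R)"
        by (intro compact_continuous_image continuous_on_subset[OF cont]) auto
      then have "bounded (F i ` cball 0 R)"
        by (rule compact_imp_bounded)
      then show ?thesis
        unfolding bounded_iff by auto
    qed
    then obtain K where K: "\<And>i x. x \<in> cball 0 R \<Longrightarrow> \<bar>F i x\<bar> \<le> K i"
      by metis
    have "K i \<le> Max (range K)" for i
      by simp
    with K show ?thesis
      by (meson order_trans)
  qed
  then obtain K0 where K0: "\<And>x i. x \<in> cball 0 R \<Longrightarrow> \<bar>F i x\<bar> \<le> K0"
    by metis
  define K where "K = \<bar>K0\<bar> + 1"
  have K: "\<bar>F i (Z t)\<bar> \<le> K" "0 < K" if "0 \<le> t" for i t
    using K0[OF Z_cball[OF that], of i] by (auto simp: K_def)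
  have mvt: "\<exists>x\<in>{s..t}. Z t $ i - Z s $ i = (t - s) * F i (Z x)" if "0 \<le> s" "s < t" for s t i
  proof -
    have "((\<lambda>t. Z t $ i) has_derivative (*) (F i (Z x))) (at x within {s..t})"
      if "s \<le> x" "x \<le> t" for x
      using has_derivative_subset[OF der[of x i, unfolded has_field_derivative_def], of "{s..t}"]
        that \<open>0 \<le> s\<close> by auto
    from mvt_very_simple[OF less_imp_le[OF \<open>s < t\<close>] this]
    show ?thesis
      by (auto simp: mult.commute)
  qed
  \<comment> \<open>The speed bound is uniform in time, so the windows around the times
    \<open>T n\<close> in which the orbit stays near \<open>y\<close> have a length independent of
    \<open>n\<close>.\<close>
  have lipschitz: "norm (Z t - Z s) \<le> real CARD('i) * K * \<bar>t - s\<bar>" if "0 \<le> s" "0 \<le> t" for s t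
  proof -
    have *: "\<bar>Z t $ i - Z s $ i\<bar> \<le> K * \<bar>t - s\<bar>" if st: "0 \<le> s" "s < t" for i s t
    proof -
      obtain x where "x \<in> {s..t}" "Z t $ i - Z s $ i = (t - s) * F i (Z x)"
        using mvt[OF st] by blast
      with K(1)[of x i] st show ?thesis
        by (simp add: abs_mult mult.commute mult_left_mono)
    qed
    have "\<bar>(Z t - Z s) $ i\<bar> \<le> K * \<bar>t - s\<bar>" for i
      using *[of s t i] *[of t s i] that
      by (cases s t rule: linorder_cases) (auto simp: abs_minus_commute)
    then have "(\<Sum>i\<in>UNIV. \<bar>(Z t - Z s) $ i\<bar>) \<le> real CARD('i) * (K * \<bar>t - s\<bar>)"
      by (intro sum_bounded_above) auto
    with norm_le_l1_cart[of "Z t - Z s"] show ?thesis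
      by (simp add: mult.assoc)
  qed
  have stat: "F i y = 0" if yi: "y $ i = Q" for i
  proof (rule ccontr)
    assume ne: "F i y \<noteq> 0"
    define c where "c = \<bar>F i y\<bar> / 2"
    have c: "0 < c"
      using ne by (simp add: c_def)
    have "isCont (F i) y"
      using cont by (simp add: continuous_on_eq_continuous_at)
    then obtain d where d: "0 < d" "\<And>x. dist x y < d \<Longrightarrow> dist (F i x) (F i y) < c"
      using c unfolding continuous_at_eps_delta by blast
    \<comment> \<open>Within time \<open>h\<close> the orbit moves by at most \<open>d / 2\<close>.
      Starting within \<open>d / 2\<close> of \<open>y\<close>, it stays where \<open>F i\<close>
      differs from \<open>F i y\<close> by less than half the size of the latter, hence keeps its
      sign and has modulus above \<open>c\<close>.\<close>
    define h where "h = d / (2 * (real CARD('i) * K))"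
    have CK: "0 < real CARD('i) * K"
      using K(2)[of 0] by simp
    have h: "0 < h" "real CARD('i) * K * h = d / 2"
      using CK d by (auto simp: h_def)
    have near: "\<bar>F i (Z t) - F i y\<bar> < c"
      if "0 \<le> s" "0 \<le> t" "dist (Z s) y < d / 2" "\<bar>t - s\<bar> \<le> h" for s t
    proof -
      have "dist (Z t) (Z s) \<le> real CARD('i) * K * h"
        using order_trans[OF lipschitz[OF that(1,2)] mult_left_mono[OF that(4)]] CK
        by (simp add: dist_norm)
      then have "dist (Z t) y < d"
        using dist_triangle[of "Z t" y "Z s"] that h by simp
      with d(2) show ?thesis
        by (simp add: dist_real_def)
    qed
    \<comment> \<open>Across a window of length \<open>h\<close> the coordinate changes by more than
      \<open>h * c\<close>, and at \<open>T n\<close> it lies above \<open>Q - h * c / 2\<close>. It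
      thus exceeds \<open>Q + h * c / 2\<close> at \<open>T n + h\<close> if \<open>F i y\<close> is
      positive, and at \<open>T n - h\<close> if negative. As \<open>q\<close> never increases, the
      single bound on \<open>q\<close> at \<open>T n - h\<close> contradicts both.\<close>
    have "\<forall>\<^sub>F n in sequentially. h \<le> T n"
      using T by (simp add: filterlim_at_top)
    moreover have "\<forall>\<^sub>F n in sequentially. dist (Z (T n)) y < d / 2"
      using y' d by (intro tendstoD) auto
    moreover have "\<forall>\<^sub>F n in sequentially. q (T n - h) < Q + h * c / 2"
    proof -
      have "filterlim (\<lambda>n. - h + T n) at_top sequentially"
        by (rule filterlim_tendsto_add_at_top[OF tendsto_const T])
      then have "(\<lambda>n. q (- h + T n)) \<longlonglongrightarrow> Q"
        by (rule filterlim_compose[OF q_lim])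
      then have "\<forall>\<^sub>F n in sequentially. q (- h + T n) < Q + h * c / 2"
        using h c by (intro order_tendstoD) auto
      then show ?thesis
        by simp
    qed
    moreover have "\<forall>\<^sub>F n in sequentially. Q - h * c / 2 < Z (T n) $ i"
      using yj[of i] h c yi by (intro order_tendstoD) auto
    ultimately have "\<forall>\<^sub>F n in sequentially. h \<le> T n \<and> dist (Z (T n)) y < d / 2 \<and>
        q (T n - h) < Q + h * c / 2 \<and> Q - h * c / 2 < Z (T n) $ i"
      by eventually_elim simp
    then obtain n where n: "h \<le> T n" "dist (Z (T n)) y < d / 2"
        "q (T n - h) < Q + h * c / 2" "Q - h * c / 2 < Z (T n) $ i"
      using eventually_happens'[OF sequentially_bot] by blast
    let ?t = "T n"
    have t0: "0 \<le> ?t"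
      using n h by simp
    show False
    proof (cases "0 < F i y")
      case True
      obtain x where x: "x \<in> {?t..?t + h}" "Z (?t + h) $ i - Z ?t $ i = h * F i (Z x)"
        using mvt[of ?t "?t + h" i] t0 h by auto
      have "\<bar>F i (Z x) - F i y\<bar> < c"
        using x(1) t0 n(2) by (intro near[of ?t x]) auto
      then have "c < F i (Z x)"
        using True unfolding c_def by linarith
      then have "h * c < h * F i (Z x)"
        using h by simp
      with x n Z_le_q[of "?t + h" i] q_antimono[of "?t - h" "?t + h"] h show False
        by simp
    next
      case False
      obtain x where x: "x \<in> {?t - h..?t}" "Z ?t $ i - Z (?t - h) $ i = h * F i (Z x)"
        using mvt[of "?t - h" ?t i] n h by auto
      have "\<bar>F i (Z x) - F i y\<bar> < c"
        using x(1) t0 n(1,2) by (intro near[of ?t x]) auto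
      then have "F i (Z x) < - c"
        using False unfolding c_def by linarith
      then have "h * F i (Z x) < h * (- c)"
        using h by (intro mult_strict_left_mono)
      with x n Z_le_q[of "?t - h" i] h show False
        by simp
    qed
  qed
  have spread: "y $ l = Q" if "y $ k = Q" "(k, l) \<in> {(k, l). l \<in> V k}\<^sup>*" for k l
    using that(2)
  proof (induction rule: rtrancl_induct)
    case (step l l')
    then show ?case
      using max_eq[of y l l'] stat[of l] y_le by simp
  qed (use that in simp)
  \<comment> \<open>There are finitely many nodes: if every coordinate of \<open>y\<close> were
    below \<open>Q\<close>, then at some time \<open>T n\<close> all coordinates would be, and so
    would their maximum \<open>q (T n)\<close>.\<close>
  have "\<exists>k. y $ k = Q"
  proof (rule ccontr)
    assume "\<not> ?thesis"
    with y_le have less: "y $ j < Q" for j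
      by (metis le_less)
    have "\<forall>\<^sub>F n in sequentially. \<forall>j. Z (T n) $ j < Q"
      using yj less by (intro eventually_all_finite) (metis order_tendstoD(2))
    moreover have "\<forall>\<^sub>F n in sequentially. 0 \<le> T n"
      by (simp add: T_def)
    ultimately have "\<forall>\<^sub>F n in sequentially. False"
    proof eventually_elim
      case (elim n)
      then show ?case
        using q_attained[of "T n"] Q_le[of "T n"] by (metis not_less)
    qed
    then show False
      by simp
  qed
  then have y_Q: "y $ j = Q" for j
    using spread graph unfolding strongly_connected_graph_def by metis
  \<comment> \<open>Convergence along a subsequence is enough: once all coordinates exceed
    \<open>x\<close> at a single time, the minimum principle keeps them above \<open>x\<close> for
    ever, while \<open>q\<close> squeezes them from above.\<close>
  have "((\<lambda>t. Z t $ i) \<longlongrightarrow> Q) at_top" for i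
  proof (rule order_tendstoI)
    fix x assume "x < Q"
    then have "\<forall>\<^sub>F n in sequentially. \<forall>j. x < Z (T n) $ j"
      using yj y_Q by (intro eventually_all_finite) (metis order_tendstoD(1))
    then obtain n where n: "\<And>j. x < Z (T n) $ j"
      using eventually_happens'[OF sequentially_bot] by blast
    have 1: "x < Min (range (\<lambda>j. Z (T n) $ j))"
      using n by (subst Min_gr_iff) auto
    have "Min (range (\<lambda>j. Z (T n) $ j)) \<le> Z t $ i" if "T n \<le> t" for t
      by (rule above[of _ "T n"]) (use that in \<open>auto simp: T_def\<close>)
    with 1 show "\<forall>\<^sub>F t in at_top. x < Z t $ i"
      by (intro eventually_at_top_linorderI[of "T n"]) (metis less_le_trans)
  next
    fix x assume "Q < x"
    then have "\<forall>\<^sub>F t in at_top. q t < x"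
      using q_lim by (rule order_tendstoD(2)[rotated])
    then show "\<forall>\<^sub>F t in at_top. Z t $ i < x"
      by eventually_elim (use Z_le_q le_less_trans in blast)
  qed
  then show ?thesis
    by blast
qed

section \<open>From the flow to the normalised values\<close>

lemma tendsto_SUP_finite:
  fixes f :: "'i::finite \<Rightarrow> 'a \<Rightarrow> real"
  assumes "\<And>i. (f i \<longlongrightarrow> c) G"
  shows "((\<lambda>t. SUP i. f i t) \<longlongrightarrow> c) G"
proof (rule order_tendstoI)
  fix x assume "x < c"
  then have "\<forall>\<^sub>F t in G. \<forall>i. x < f i t"
    by (intro eventually_all_finite order_tendstoD(1)[OF assms])
  then show "\<forall>\<^sub>F t in G. x < (SUP i. f i t)"
    by eventually_elim (auto simp: less_cSUP_iff)
next
  fix x assume "c < x"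
  then have "\<forall>\<^sub>F t in G. \<forall>i. f i t < x"
    by (intro eventually_all_finite order_tendstoD(2)[OF assms])
  then show "\<forall>\<^sub>F t in G. (SUP i. f i t) < x"
    by eventually_elim (auto simp: cSup_eq_Max)
qed

theorem theorem3:
  fixes V :: "'i::finite \<Rightarrow> 'i set"
    and L :: "'i \<Rightarrow> ('i \<Rightarrow> real) \<Rightarrow> ereal"
    and g :: "'i \<Rightarrow> real"
    and M :: "'w measure"
    and F :: "real \<Rightarrow> 'w measure"
    and X :: "real \<Rightarrow> real \<Rightarrow> 'i \<Rightarrow> 'i rates \<Rightarrow> real \<Rightarrow> 'w \<Rightarrow> 'i"
    and ur :: "real \<Rightarrow> 'i \<Rightarrow> real"
    and \<gamma> :: real
    and rn :: "nat \<Rightarrow> real"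
    and i1 :: 'i
    and \<xi> :: "'i \<Rightarrow> real"
    and U :: "'i \<Rightarrow> real \<Rightarrow> real"
    and v :: "'i \<Rightarrow> real \<Rightarrow> real"
    and q :: "real \<Rightarrow> real"
  assumes graph: "strongly_connected_graph V"
    and cost: "cost_functions V L"
    and prob: "prob_space M"
    and filtr: "usual_filtration M F"
    and chain: "\<And>t T i a. 0 \<le> t \<Longrightarrow> t \<le> T \<Longrightarrow> a \<in> admissible V t T \<Longrightarrow>
                  markov_chain_with_rates M F V t T i a (X t T i a)"
    and ur: "\<And>r i t. 0 < r \<Longrightarrow> 0 \<le> t \<Longrightarrow>
               ((\<lambda>T. value_function M V L g X T r i t) \<longlongrightarrow> ereal (ur r i)) at_top"
    and gamma: "\<And>i. ((\<lambda>r. r * ur r i) \<longlongrightarrow> \<gamma>) (at_right 0)"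
    and rn_pos: "\<And>n. 0 < rn n"
    and rn_lim: "rn \<longlonglongrightarrow> 0"
    and xi: "\<And>i. (\<lambda>n. ur (rn n) i - ur (rn n) i1) \<longlonglongrightarrow> \<xi> i"
    and U: "C1_solution V L g U"
    and H_strict: "\<And>i j p x y. j \<in> V i \<Longrightarrow> x < y \<Longrightarrow>
                     hamiltonian V L i (p(j := x)) < hamiltonian V L i (p(j := y))"
    and v_def: "\<And>i t. v i t = U i t - \<gamma> * t"
    and q_def: "\<And>t. q t = (SUP i. v i t - \<xi> i)"
  shows "\<exists>q_inf. (q \<longlongrightarrow> q_inf) at_top \<and>
           (\<forall>i. ((\<lambda>t. v i t) \<longlongrightarrow> \<xi> i + q_inf) at_top)"
proof -
  have irrefl: "k \<notin> V k" for k
    using graph by (simp add: strongly_connected_graph_def)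
  have discounted: "r * ur r i = hamiltonian V L i (\<lambda>j. ur r j - ur r i)" if r: "0 < r" for r i
  proof -
    obtain w where w: "\<And>i. r * w i = hamiltonian V L i (\<lambda>j. w j - w i)"
      using stationary_solution_exists[OF cost r] by blast
    \<comment> \<open>The identification holds at every node, so \<open>ur r\<close> inherits the
      whole coupled system from \<open>w\<close>.\<close>
    have "ur r i = w i" for i
      by (rule value_function_limit[OF irrefl cost prob filtr chain[OF order_refl] r w ur[OF r order_refl]])
    with w show ?thesis
      by simp
  qed
  have ergodic: "\<gamma> = hamiltonian V L i (\<lambda>j. \<xi> j - \<xi> i)" for i
  proof (rule LIMSEQ_unique)
    have "filterlim rn (at_right 0) sequentially"
      using rn_lim rn_pos by (auto simp: filterlim_at intro!: always_eventually less_imp_neq[symmetric])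
    then show "(\<lambda>n. rn n * ur (rn n) i) \<longlonglongrightarrow> \<gamma>"
      by (rule filterlim_compose[OF gamma])
    have "(\<lambda>n. ur (rn n) j - ur (rn n) i) \<longlonglongrightarrow> \<xi> j - \<xi> i" for j
      using tendsto_diff[OF xi[of j] xi[of i]] by simp
    then show "(\<lambda>n. rn n * ur (rn n) i) \<longlonglongrightarrow> hamiltonian V L i (\<lambda>j. \<xi> j - \<xi> i)"
      unfolding discounted[OF rn_pos] by (rule tendsto_hamiltonian[OF cost])
  qed
  \<comment> \<open>The field in the coordinates \<open>v - \<xi>\<close>. The drift
    \<open>\<gamma> * t\<close> is common to all nodes and cancels in the differences of
    \<open>U\<close>; subtracting \<open>\<gamma>\<close> makes every constant vector a zero, by
    \<open>ergodic\<close>.\<close>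
  define H where "H i x = hamiltonian V L i (\<lambda>j. x $ j - x $ i + (\<xi> j - \<xi> i)) - \<gamma>"
    for i and x :: "real^'i"
  define Z where "Z t = (\<chi> i. v i t - \<xi> i)" for t
  have "\<exists>c. \<forall>i. ((\<lambda>t. Z t $ i) \<longlongrightarrow> c) at_top"
  proof (rule cooperative_flow_converges[OF graph, where F = H])
    show "continuous_on UNIV (H i)" for i
      unfolding continuous_on_def H_def
      by (intro ballI tendsto_intros tendsto_hamiltonian[OF cost])
    show "H i x \<le> 0" if "\<And>j. x $ j \<le> x $ i" for i x
      using that hamiltonian_mono[OF cost, of i "\<lambda>j. x $ j - x $ i + (\<xi> j - \<xi> i)" "\<lambda>j. \<xi> j - \<xi> i"]
      by (simp add: H_def ergodic[of i])
    show "0 \<le> H i x" if "\<And>j. x $ i \<le> x $ j" for i x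
      using that hamiltonian_mono[OF cost, of i "\<lambda>j. \<xi> j - \<xi> i" "\<lambda>j. x $ j - x $ i + (\<xi> j - \<xi> i)"]
      by (simp add: H_def ergodic[of i])
    show "x $ j = x $ i" if le: "\<And>j. x $ j \<le> x $ i" and eq: "H i x = 0" and j: "j \<in> V i" for i j x
    proof (rule ccontr)
      assume "x $ j \<noteq> x $ i"
      with le[of j] have "x $ j < x $ i"
        by simp
      then have "hamiltonian V L i (\<lambda>j. x $ j - x $ i + (\<xi> j - \<xi> i)) < hamiltonian V L i (\<lambda>j. \<xi> j - \<xi> i)"
        using le j by (intro hamiltonian_strict_mono[OF cost H_strict]) auto
      with eq show False
        by (simp add: H_def ergodic[of i])
    qed
    fix i and t :: real assume t: "0 \<le> t"
    obtain U' where "(U i has_real_derivative U' i t) (at t within {0..})"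
      "U' i t = hamiltonian V L i (\<lambda>j. U j t - U i t)"
      using U t unfolding C1_solution_def by force
    then show "((\<lambda>t. Z t $ i) has_real_derivative H i (Z t)) (at t within {0..})"
      by (auto simp: Z_def H_def v_def intro!: derivative_eq_intros)
  qed
  then obtain c where c: "\<And>i. ((\<lambda>t. v i t - \<xi> i) \<longlongrightarrow> c) at_top"
    by (auto simp: Z_def)
  have "(q \<longlongrightarrow> c) at_top"
    using tendsto_SUP_finite[OF c] by (simp add: q_def[abs_def])
  moreover have "((\<lambda>t. v i t) \<longlongrightarrow> \<xi> i + c) at_top" for i
    using tendsto_add[OF tendsto_const c, of "\<xi> i" i] by simp
  ultimately show ?thesis
    by blast
qed

end
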